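(* Let $\|\cdot\|_*$ be a norm on $\mathbb{R}^d$ that is differentiable at every $p\in\mathbb{R}^d\setminus\{0\}$, with dual norm $\|x\|=\sup\{\langle x,p\rangle:\|p\|_*=1\}$. Let $a,A\in(1,\infty)$, $b=a/(a-1)$, $B=A/(A-1)$, $\gamma\in(0,1)$, and $$k(p)=\varphi_a^A(\|p\|_* ).$$ Let $f:\mathbb{R}^d\to\mathbb{R}$ be differentiable and convex with unique minimizer $x_\star$, and assume there exist $\mu,L\in(0,\infty)$ such that for all $x\in\mathbb{R}^d$ $$f(x)-f(x_\star)\ge\mu\,\varphi_b^B(\|x-x_\star\|),\qquad\varphi_a^A(\|\nabla f(x)\|_* )\le L\,(f(x)-f(x_\star)).$$ Then: 1. Conditions (A) and (B) of the context hold, with $\alpha$ constant and $$\alpha=\min\{\mu^{a-1},\mu^{A-1},1\},\quad C_{\alpha,\gamma}=\gamma,\quad C_{f,k}=\max\{a-1,A-1,L\}.$$ 2. If in addition $b\ge2$, $B\ge2$, $f$ is twice continuously differentiable on $\mathbb{R}^d\setminus\{x_\star\}$, and there exist $L_f,D_f\in(0,\infty)$ such that for all $x\in\mathbb{R}^d\setminus\{x_\star\}$ $$\big(\varphi_{b/2}^{B/2}\big)^*\Big(\frac{\lambda_{\max}^{\|\cdot\|}(\nabla^2f(x))}{L_f}\Big)\le D_f\,(f(x)-f(x_\star)),$$ then conditions (A), (B) and (C) hold with the constants of part 1 and $$C_k=\max\{a,A\},\qquad D_{f,k}=L_f\,\alpha^{-1}\max\{D_f,\,2C_{a,A}(\max\{a,A\}-1)\}.$$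 3. If in addition (to the assumptions preceding part 1) $b\le2$, $B\le2$, $\|\cdot\|_*$ is twice continuously differentiable on $\mathbb{R}^d\setminus\{0\}$, and there exists $N\in(0,\infty)$ such that $\lambda_{\max}^{\|\cdot\|_*}(\nabla^2\|p\|_* )\le N\|p\|_*^{-1}$ for all $p\in\mathbb{R}^d\setminus\{0\}$, then conditions (A), (B) and (D) hold with the constants of part 1 and $$C_k=\max\{a,A\},\quad D_k=\max\{a,A\}(\max\{a,A\}-1),\quad E_k=\max\{a,A\}-1,\quad F_k=1,$$ $$D_{f,k}=\alpha^{-1}(\max\{a,A\}-1+N)\max\{2L,a-2,A-2\}.$$
   Context: For $a,A\in[1,\infty)$ and $t\in[0,\infty)$, $\varphi_a^A(t)=\frac1A(t^a+1)^{A/a}-\frac1A$, and $(\varphi_a^A)^*(t)=\sup_{s\ge0}\{ts-\varphi_a^A(s)\}\in[0,\infty]$ for $t\ge0$. For a norm $\|\cdot\|$ on $\mathbb{R}^d$ and $M\in\mathbb{R}^{d\times d}$, $\lambda_{\max}^{\|\cdot\|}(M)=\sup\{\langle v,Mv\rangle:v\in\mathbb{R}^d,\|v\|=1\}$. For $a,A>1$, $a\ne A$, with $b=a/(a-1)$, $B=A/(A-1)$, $$C_{a,A}=\Big(1-\big(\tfrac{a-1}{A-1}\big)^{\frac{a-1}{A-a}}+\big(\tfrac{a-1}{A-1}\big)^{\frac{A-1}{A-a}}\Big)^{\frac{B-b}{b}},$$ and $C_{a,a}=1$. Write $\mathcal{H}(x,p)=k(p)+f(x)-f(x_\star)$, $f_c(x)=f(x+x_\star)-f(x_\star)$,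 $f_c^*(p)=\sup\{\langle x,p\rangle-f_c(x):x\in\mathbb{R}^d\}$. The conditions are: (A) $f$ is differentiable and convex with unique minimizer $x_\star$; $k$ is differentiable and strictly convex with minimum $k(0)=0$; $\gamma\in(0,1)$; $\alpha:[0,\infty)\to(0,1]$ is differentiable, non-increasing and convex and $C_{\alpha,\gamma}\in(0,\gamma]$ satisfy $k(p)\ge\alpha(k(p))\max(f_c^*(p),f_c^*(-p))$ for all $p\in\mathbb{R}^d$ and $-C_{\alpha,\gamma}\alpha'(y)y<\alpha(y)$ for all $y\ge0$. (B) $C_{f,k}\in(0,\infty)$ and $|\langle\nabla f(x),\nabla k(p)\rangle|\le C_{f,k}\mathcal{H}(x,p)$ for all $x,p\in\mathbb{R}^d$. (C) $f$ is convex with a unique minimizer $x_\star$ and is twice continuously differentiable on $\mathbb{R}^d\setminus\{x_\star\}$; $\langle\nabla k(p),p\rangle\le C_kk(p)$ for all $p\in\mathbb{R}^d$; and $\langle\nabla k(p),\nabla^2f(x)\nabla k(p)\rangle\le D_{f,k}\,\alpha(3\mathcal{H}(x,p))\,\mathcal{H}(x,p)$ for all $p\in\mathbb{R}^d$, $x\in\mathbb{R}^d\setminus\{x_\star\}$. (D) $k$ is strictly convex with minimum $k(0)=0$ and twice continuously differentiable on $\mathbb{R}^d\setminus\{0\}$; $\langle\nabla k(p),p\rangle\le C_kk(p)$ for all $p\in\mathbb{R}^d$; $\langle p,\nabla^2k(p)p\rangle\le D_kk(p)$ for all $p\ne0$; $k(p)-k(q)\le E_kk(q)+F_k\langle\nabla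 k(p)-\nabla k(q),p-q\rangle$ for all $p,q\in\mathbb{R}^d$; and $\langle\nabla f(x),\nabla^2k(p)\nabla f(x)\rangle\le D_{f,k}\,\alpha(3\mathcal{H}(x,p))\,\mathcal{H}(x,p)$ for all $x\in\mathbb{R}^d$, $p\ne0$.
   Formalization: Strict convexity of k in conditions (A) and (D) is claimed only when the norm ‖·‖_* is strictly convex (it fails otherwise, e.g. for a smooth stadium-shaped norm); for other norms (A) and (D) are proved with k convex instead. *)

theory Defs
  imports "HOL-Analysis.Analysis"
begin

section \<open>Calculus and convexity on \<open>real^'d\<close>\<close>

definition grad :: "(real^'d \<Rightarrow> real) \<Rightarrow> real^'d \<Rightarrow> real^'d" where
  "grad f x = (THE D. GDERIV f x :> D)"

definition hessian :: "(real^'d \<Rightarrow> real) \<Rightarrow> real^'d \<Rightarrow> real^'d^'d" where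
  "hessian f x = jacobian (grad f) (at x)"

text \<open>Only used for open sets \<open>S\<close>.\<close>

definition twice_cont_differentiable_on :: "(real^'d) set \<Rightarrow> (real^'d \<Rightarrow> real) \<Rightarrow> bool" where
  "twice_cont_differentiable_on S f \<longleftrightarrow>
     (\<forall>x\<in>S. f differentiable (at x)) \<and>
     (\<forall>x\<in>S. grad f differentiable (at x)) \<and>
     continuous_on S (hessian f)"

definition strictly_convex :: "(real^'d \<Rightarrow> real) \<Rightarrow> bool" where
  "strictly_convex f \<longleftrightarrow>
     (\<forall>x y. \<forall>u v. x \<noteq> y \<and> u > 0 \<and> v > 0 \<and> u + v = 1 \<longrightarrow>
        f (u *\<^sub>R x + v *\<^sub>R y) < u * f x + v * f y)"

definition unique_minimizer :: "(real^'d \<Rightarrow> real) \<Rightarrow> real^'d \<Rightarrow> bool" where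
  "unique_minimizer f xs \<longleftrightarrow> (\<forall>x. x \<noteq> xs \<longrightarrow> f xs < f x)"

section \<open>Norms\<close>

definition is_norm :: "(real^'d \<Rightarrow> real) \<Rightarrow> bool" where
  "is_norm N \<longleftrightarrow>
     (\<forall>x. N x = 0 \<longleftrightarrow> x = 0) \<and>
     (\<forall>c x. N (c *\<^sub>R x) = \<bar>c\<bar> * N x) \<and>
     (\<forall>x y. N (x + y) \<le> N x + N y)"

definition strictly_convex_norm :: "(real^'d \<Rightarrow> real) \<Rightarrow> bool" where
  "strictly_convex_norm N \<longleftrightarrow>
     (\<forall>p q. N p = 1 \<and> N q = 1 \<and> p \<noteq> q \<longrightarrow> N (p + q) < 2)"

definition dual_norm :: "(real^'d \<Rightarrow> real) \<Rightarrow> real^'d \<Rightarrow> real" where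
  "dual_norm N x = (SUP p\<in>{p. N p = 1}. x \<bullet> p)"

definition lambda_max :: "(real^'d \<Rightarrow> real) \<Rightarrow> real^'d^'d \<Rightarrow> real" where
  "lambda_max N M = (SUP v\<in>{v. N v = 1}. v \<bullet> (M *v v))"

section \<open>The power functions\<close>

definition phi :: "real \<Rightarrow> real \<Rightarrow> real \<Rightarrow> real" where
  "phi a A t = (1 / A) * (t powr a + 1) powr (A / a) - 1 / A"

definition phi_conj :: "real \<Rightarrow> real \<Rightarrow> real \<Rightarrow> ereal" where
  "phi_conj a A t = (SUP s\<in>{0..}. ereal (t * s - phi a A s))"

definition C_const :: "real \<Rightarrow> real \<Rightarrow> real" where
  "C_const a A =
     (if a = A then 1
      else (let b = a / (a - 1); B = A / (A - 1); r = (a - 1) / (A - 1) in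
        (1 - r powr ((a - 1) / (A - a)) + r powr ((A - 1) / (A - a))) powr ((B - b) / b)))"

section \<open>The conditions\<close>

text \<open>Throughout, \<open>xs\<close> stands for the minimizer of \<open>f\<close>.\<close>

definition Ham :: "(real^'d \<Rightarrow> real) \<Rightarrow> (real^'d \<Rightarrow> real) \<Rightarrow> real^'d \<Rightarrow> real^'d \<Rightarrow> real^'d \<Rightarrow> real"
  where "Ham f k xs x p = k p + f x - f xs"

definition centered :: "(real^'d \<Rightarrow> real) \<Rightarrow> real^'d \<Rightarrow> real^'d \<Rightarrow> real" where
  "centered f xs x = f (x + xs) - f xs"

definition centered_conj :: "(real^'d \<Rightarrow> real) \<Rightarrow> real^'d \<Rightarrow> real^'d \<Rightarrow> ereal" where
  "centered_conj f xs p = (SUP x. ereal (x \<bullet> p - centered f xs x))"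

text \<open>
  Conditions (A) and (D) require \<open>k\<close> to be strictly convex. Each is split into the condition with
  plain convexity (\<open>condition_A_convex\<close>, \<open>condition_D_convex\<close>) and the full condition
  (\<open>condition_A\<close>, \<open>condition_D\<close>), because for \<open>k p = phi a A (N p)\<close> strict convexity of \<open>k\<close>
  holds only if the norm \<open>N\<close> is itself strictly convex; see \<open>strictly_convex_phi_norm_imp\<close> below.
\<close>

definition condition_A_convex ::
  "(real^'d \<Rightarrow> real) \<Rightarrow> (real^'d \<Rightarrow> real) \<Rightarrow> real^'d \<Rightarrow> real \<Rightarrow> (real \<Rightarrow> real) \<Rightarrow> real \<Rightarrow> bool" where
  "condition_A_convex f k xs \<gamma> \<alpha> C \<longleftrightarrow>
     (\<forall>x. f differentiable (at x)) \<and> convex_on UNIV f \<and> unique_minimizer f xs \<and>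
     (\<forall>p. k differentiable (at p)) \<and> convex_on UNIV k \<and> k 0 = 0 \<and> (\<forall>p. 0 \<le> k p) \<and>
     0 < \<gamma> \<and> \<gamma> < 1 \<and>
     \<alpha> \<in> {0..} \<rightarrow> {0<..1} \<and>
     (\<forall>y\<ge>0. \<alpha> differentiable (at y within {0..})) \<and>
     antimono_on {0..} \<alpha> \<and> convex_on {0..} \<alpha> \<and>
     0 < C \<and> C \<le> \<gamma> \<and>
     (\<forall>p. ereal (\<alpha> (k p)) * max (centered_conj f xs p) (centered_conj f xs (- p)) \<le> ereal (k p)) \<and>
     (\<forall>y\<ge>0. - C * vector_derivative \<alpha> (at y within {0..}) * y < \<alpha> y)"

definition condition_A ::
  "(real^'d \<Rightarrow> real) \<Rightarrow> (real^'d \<Rightarrow> real) \<Rightarrow> real^'d \<Rightarrow> real \<Rightarrow> (real \<Rightarrow> real) \<Rightarrow> real \<Rightarrow> bool" where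
  "condition_A f k xs \<gamma> \<alpha> C \<longleftrightarrow> condition_A_convex f k xs \<gamma> \<alpha> C \<and> strictly_convex k"

definition condition_B ::
  "(real^'d \<Rightarrow> real) \<Rightarrow> (real^'d \<Rightarrow> real) \<Rightarrow> real^'d \<Rightarrow> real \<Rightarrow> bool" where
  "condition_B f k xs C \<longleftrightarrow>
     0 < C \<and> (\<forall>x p. \<bar>grad f x \<bullet> grad k p\<bar> \<le> C * Ham f k xs x p)"

definition condition_C ::
  "(real^'d \<Rightarrow> real) \<Rightarrow> (real^'d \<Rightarrow> real) \<Rightarrow> real^'d \<Rightarrow> (real \<Rightarrow> real) \<Rightarrow> real \<Rightarrow> real \<Rightarrow> bool" where
  "condition_C f k xs \<alpha> Ck Dfk \<longleftrightarrow>
     convex_on UNIV f \<and> unique_minimizer f xs \<and>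
     twice_cont_differentiable_on (- {xs}) f \<and>
     (\<forall>p. grad k p \<bullet> p \<le> Ck * k p) \<and>
     (\<forall>p x. x \<noteq> xs \<longrightarrow>
        grad k p \<bullet> (hessian f x *v grad k p) \<le> Dfk * \<alpha> (3 * Ham f k xs x p) * Ham f k xs x p)"

definition condition_D_convex ::
  "(real^'d \<Rightarrow> real) \<Rightarrow> (real^'d \<Rightarrow> real) \<Rightarrow> real^'d \<Rightarrow> (real \<Rightarrow> real) \<Rightarrow>
     real \<Rightarrow> real \<Rightarrow> real \<Rightarrow> real \<Rightarrow> real \<Rightarrow> bool" where
  "condition_D_convex f k xs \<alpha> Ck Dk Ek Fk Dfk \<longleftrightarrow>
     convex_on UNIV k \<and> k 0 = 0 \<and> (\<forall>p. 0 \<le> k p) \<and>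
     twice_cont_differentiable_on (- {0}) k \<and>
     (\<forall>p. grad k p \<bullet> p \<le> Ck * k p) \<and>
     (\<forall>p. p \<noteq> 0 \<longrightarrow> p \<bullet> (hessian k p *v p) \<le> Dk * k p) \<and>
     (\<forall>p q. k p - k q \<le> Ek * k q + Fk * ((grad k p - grad k q) \<bullet> (p - q))) \<and>
     (\<forall>x p. p \<noteq> 0 \<longrightarrow>
        grad f x \<bullet> (hessian k p *v grad f x) \<le> Dfk * \<alpha> (3 * Ham f k xs x p) * Ham f k xs x p)"

definition condition_D ::
  "(real^'d \<Rightarrow> real) \<Rightarrow> (real^'d \<Rightarrow> real) \<Rightarrow> real^'d \<Rightarrow> (real \<Rightarrow> real) \<Rightarrow>
     real \<Rightarrow> real \<Rightarrow> real \<Rightarrow> real \<Rightarrow> real \<Rightarrow> bool" where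
  "condition_D f k xs \<alpha> Ck Dk Ek Fk Dfk \<longleftrightarrow>
     condition_D_convex f k xs \<alpha> Ck Dk Ek Fk Dfk \<and> strictly_convex k"

section \<open>Strict convexity of the kinetic energy forces a strictly convex norm\<close>

lemma strictly_convex_phi_norm_imp:
  assumes N: "is_norm N" and a: "a > 1" and A: "A > 1"
    and k: "strictly_convex (\<lambda>p. phi a A (N p))"
  shows "strictly_convex_norm N"
  unfolding strictly_convex_norm_def
proof (intro allI impI)
  fix p q assume pq: "N p = 1 \<and> N q = 1 \<and> p \<noteq> q"
  define m where "m = (1/2) *\<^sub>R p + (1/2) *\<^sub>R q"
  have m: "N m = N (p + q) / 2"
  proof -
    have "m = (1/2) *\<^sub>R (p + q)" by (simp add: m_def scaleR_add_right)
    moreover have "N ((1/2) *\<^sub>R (p + q)) = \<bar>1/2\<bar> * N (p + q)"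
      using N unfolding is_norm_def by blast
    ultimately show ?thesis by simp
  qed
  have "phi a A (N m) < (1/2) * phi a A (N p) + (1/2) * phi a A (N q)"
    unfolding m_def using k[unfolded strictly_convex_def, rule_format, of p q "1/2" "1/2"] pq
    by simp
  hence lt: "phi a A (N m) < phi a A 1" using pq by simp
  have "N m < 1"
  proof (rule ccontr)
    assume "\<not> N m < 1"
    hence "1 powr a \<le> N m powr a" using a by (intro powr_mono2) auto
    hence "(1 powr a + 1) powr (A / a) \<le> (N m powr a + 1) powr (A / a)"
      using a A by (intro powr_mono2) auto
    hence "phi a A 1 \<le> phi a A (N m)"
      unfolding phi_def using A by (simp add: divide_right_mono)
    thus False using lt by simp
  qed
  thus "N (p + q) < 2" using m by simp
qed

end

theory Submission
  imports Defs
begin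

text \<open>
  Write \<open>\<phi> = phi a A\<close> and \<open>m = max a A\<close>. The logarithmic derivative of \<open>\<phi>'\<close> shows that \<open>t \<phi>''(t) / \<phi>'(t)\<close>
  lies between \<open>min a A - 1\<close> and \<open>m - 1\<close>, which gives \<open>t \<phi>'(t) \<le> m \<phi>(t)\<close>; moreover
  \<open>s t \<le> phi a A s + phi b B t\<close>. The gradient \<open>n\<close> of the norm at \<open>p\<close> satisfies \<open>n \<bullet> p = \<parallel>p\<parallel>\<close> and
  \<open>\<bar>n \<bullet> g\<bar> \<le> \<parallel>g\<parallel>\<close>, and \<open>\<nabla>k(p) = \<phi>'(\<parallel>p\<parallel>) n\<close>, so that everything becomes a scalar inequality:
  (A) is the Young inequality, (B) the tangent inequality for \<open>\<phi>\<close> at \<open>\<parallel>p\<parallel>\<close>, (C) the Fenchel inequality for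
  \<open>phi (b / 2) (B / 2)\<close> at \<open>r\<^sup>2\<close>, where it equals \<open>2 phi b B r\<close>, together with
  \<open>phi b B (\<phi>'(s)) \<le> C_const a A * (m - 1) \<phi>(s)\<close>, and (D) the tangent inequality for
  \<open>phi (a / 2) (A / 2)\<close> at \<open>\<parallel>p\<parallel>\<^sup>2\<close>.
\<close>

section \<open>Scalar inequalities\<close>

definition dphi :: "real \<Rightarrow> real \<Rightarrow> real \<Rightarrow> real" where
  "dphi a A t = t powr (a - 1) * (t powr a + 1) powr (A / a - 1)"

text \<open>The derivative of \<open>dphi a A\<close>, factored so that the bracket, which is
  \<open>t * ddphi a A t / dphi a A t\<close> for positive \<open>t\<close>, is visibly a weighted
  mean of \<open>a - 1\<close> and \<open>A - 1\<close>.\<close>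

definition ddphi :: "real \<Rightarrow> real \<Rightarrow> real \<Rightarrow> real" where
  "ddphi a A t = dphi a A t / t * (a - 1 + (A - a) * (t powr a / (t powr a + 1)))"

text \<open>Derivatives are asked for at positive points only, because the formulas for
  \<open>phi\<close> and \<open>dphi\<close> are proved only there; continuity takes care of
  \<open>0\<close>.\<close>

lemma nonneg_of_deriv_nonneg:
  fixes g g' :: "real \<Rightarrow> real"
  assumes "continuous_on {0..} g" "g 0 = 0" "0 \<le> t"
    and "\<And>x. 0 < x \<Longrightarrow> (g has_real_derivative g' x) (at x)"
    and "\<And>x. 0 < x \<Longrightarrow> 0 \<le> g' x"
  shows "0 \<le> g t"
proof -
  have "g 0 \<le> g t"
  proof (rule DERIV_nonneg_imp_increasing_open[where f = g])
    show "continuous_on {0..t} g"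
      using assms(1) by (rule continuous_on_subset) auto
  qed (use assms in blast)+
  thus ?thesis using assms(2) by simp
qed

lemma powr_plus_1_pos: "0 < x powr r + (1::real)"
  by (simp add: add_nonneg_pos)

lemma phi_deriv:
  assumes "0 < t" "0 < a" "0 < A"
  shows "(phi a A has_real_derivative dphi a A t) (at t)"
proof -
  have p: "t powr a + 1 > 0" by (simp add: add_nonneg_pos)
  show ?thesis
    unfolding phi_def[abs_def] dphi_def using assms p
    by (auto intro!: derivative_eq_intros simp: powr_diff mult_ac)
qed

lemma dphi_deriv:
  assumes "0 < t" "0 < a"
  shows "(dphi a A has_real_derivative ddphi a A t) (at t)"
proof -
  define u P Q where "u = t powr a" and "P = (u + 1) powr (A / a - 1)" and "Q = inverse (u + 1)"
  have p: "u + 1 > 0" by (simp add: u_def add_nonneg_pos)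
  have e: "t powr (a - 1 - 1) = t powr (a - 1) / t" "t powr (a - 1) = u / t"
      "(u + 1) powr (A / a - 1 - 1) = P / (u + 1)"
    using assms p powr_diff[of t a 1] powr_diff[of t "a - 1" 1] powr_diff[of "u + 1" "A / a - 1" 1]
    by (simp_all add: u_def P_def)
  have "(dphi a A has_real_derivative
      (a - 1) * t powr (a - 1 - 1) * (u + 1) powr (A / a - 1) +
       t powr (a - 1) * ((A / a - 1) * (u + 1) powr (A / a - 1 - 1) * (a * t powr (a - 1)))) (at t)"
    unfolding dphi_def[abs_def] u_def using assms p
    by (auto intro!: derivative_eq_intros simp: u_def)
  also have "(a - 1) * t powr (a - 1 - 1) * (u + 1) powr (A / a - 1) +
       t powr (a - 1) * ((A / a - 1) * (u + 1) powr (A / a - 1 - 1) * (a * t powr (a - 1)))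
      = ddphi a A t"
    unfolding ddphi_def dphi_def u_def[symmetric] P_def[symmetric] e divide_inverse[of _ "u + 1"] Q_def[symmetric]
    using assms by (simp add: field_simps)
  finally show ?thesis .
qed

lemma dphi_nonneg: "0 \<le> t \<Longrightarrow> 0 \<le> dphi a A t"
  by (simp add: dphi_def)

lemma dphi_pos: "0 < t \<Longrightarrow> 0 < dphi a A t"
  using powr_plus_1_pos[of t a] by (simp add: dphi_def)

lemma phi_0 [simp]: "phi a A 0 = 0" and dphi_0 [simp]: "dphi a A 0 = 0"
  by (simp_all add: phi_def dphi_def)

lemma phi_cont: "0 < a \<Longrightarrow> continuous_on {0..} (phi a A)"
  unfolding phi_def[abs_def]
  by (intro continuous_intros continuous_on_powr') (auto simp: add_nonneg_eq_0_iff)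

lemma dphi_cont: "1 < a \<Longrightarrow> continuous_on {0..} (dphi a A)"
  unfolding dphi_def[abs_def]
  by (intro continuous_intros continuous_on_powr') (auto simp: add_nonneg_eq_0_iff)

text \<open>The weight \<open>th\<close> lies in \<open>[0, 1]\<close>, so
  \<open>(1 - th) * a + th * A\<close> lies between \<open>min a A\<close> and
  \<open>max a A\<close>.\<close>

lemma ddphi_le:
  assumes "0 < t"
  shows "t * ddphi a A t \<le> (max a A - 1) * dphi a A t"
    and "(min a A - 1) * dphi a A t \<le> t * ddphi a A t"
proof -
  define th where "th = t powr a / (t powr a + 1)"
  have th: "0 \<le> th" "th \<le> 1"
    unfolding th_def using powr_plus_1_pos[of t a] by (auto simp: divide_le_eq_1)
  have e: "t * ddphi a A t = ((1 - th) * a + th * A - 1) * dphi a A t"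
  proof -
    have "t * ddphi a A t = dphi a A t * (a - 1 + (A - a) * th)"
      using assms by (simp add: ddphi_def th_def)
    thus ?thesis by (simp add: algebra_simps)
  qed
  have "(1 - th) * a + th * A \<le> (1 - th) * max a A + th * max a A"
    using th by (intro add_mono mult_left_mono) auto
  hence 1: "(1 - th) * a + th * A - 1 \<le> max a A - 1" by (simp add: algebra_simps)
  have "(1 - th) * min a A + th * min a A \<le> (1 - th) * a + th * A"
    using th by (intro add_mono mult_left_mono) auto
  hence 2: "min a A - 1 \<le> (1 - th) * a + th * A - 1" by (simp add: algebra_simps)
  show "t * ddphi a A t \<le> (max a A - 1) * dphi a A t"
    and "(min a A - 1) * dphi a A t \<le> t * ddphi a A t"
    unfolding e using 1 2 dphi_nonneg[of t a A] assms by (auto intro: mult_right_mono)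
qed

lemma ddphi_nonneg:
  assumes "0 < t" "1 \<le> a" "1 \<le> A"
  shows "0 \<le> ddphi a A t"
  using ddphi_le(2)[OF assms(1), of a A] dphi_nonneg[of t a A] assms
  by (smt (verit) mult_nonneg_nonneg zero_le_mult_iff)

lemma ddphi_pos:
  assumes "0 < t" "1 < a" "1 < A"
  shows "0 < ddphi a A t"
proof -
  have "0 < (min a A - 1) * dphi a A t" using dphi_pos[of t a A] assms by simp
  thus ?thesis using ddphi_le(2)[OF assms(1), of a A] assms by (smt (verit) zero_less_mult_pos)
qed

section \<open>Monotonicity, tangent inequalities and convexity of \<open>phi\<close>\<close>

text \<open>The exponents may equal 1 because the lemma is also applied to \<open>a / 2\<close> and
  \<open>A / 2\<close> for \<open>a\<close> and \<open>A\<close> at least 2.\<close>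

lemma dphi_mono:
  assumes "0 < s" "s \<le> t" "1 \<le> a" "1 \<le> A"
  shows "dphi a A s \<le> dphi a A t"
proof (rule DERIV_nonneg_imp_nondecreasing[OF assms(2)])
  fix x assume "s \<le> x" "x \<le> t"
  thus "\<exists>y. (dphi a A has_real_derivative y) (at x) \<and> 0 \<le> y"
    using dphi_deriv[of x a A] ddphi_nonneg[of x a A] assms by auto
qed

lemma dphi_strict_mono:
  assumes "0 < s" "s < t" "1 < a" "1 < A"
  shows "dphi a A s < dphi a A t"
proof (rule DERIV_pos_imp_increasing[OF assms(2)])
  fix x assume "s \<le> x" "x \<le> t"
  thus "\<exists>y. (dphi a A has_real_derivative y) (at x) \<and> 0 < y"
    using dphi_deriv[of x a A] ddphi_pos[of x a A] assms by auto
qed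

lemma phi_mvt:
  assumes "0 \<le> s" "s < t" "0 < a" "0 < A"
  obtains z where "s < z" "z < t" "phi a A t - phi a A s = dphi a A z * (t - s)"
proof -
  have c: "continuous_on {s..t} (phi a A)"
    using phi_cont[OF assms(3)] by (rule continuous_on_subset) (use assms in auto)
  show ?thesis
  proof (rule mvt[OF assms(2) c, of "\<lambda>z h. dphi a A z * h"])
    fix x assume "s < x" "x < t"
    thus "(phi a A has_derivative (*) (dphi a A x)) (at x)"
      using phi_deriv[of x a A] assms unfolding has_field_derivative_def by auto
  qed (use that in blast)
qed

lemma phi_strict_mono:
  assumes "0 \<le> s" "s < t" "0 < a" "0 < A"
  shows "phi a A s < phi a A t"
proof -
  obtain z where z: "s < z" "z < t" "phi a A t - phi a A s = dphi a A z * (t - s)"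
    using phi_mvt[OF assms] .
  thus ?thesis using dphi_pos[of z a A] assms
    by (smt (verit) mult_pos_pos)
qed

lemma phi_mono:
  assumes "0 \<le> s" "s \<le> t" "0 < a" "0 < A"
  shows "phi a A s \<le> phi a A t"
  using phi_strict_mono[of s t a A] assms by (cases "s = t") auto

lemma phi_nonneg: "0 \<le> t \<Longrightarrow> 0 < a \<Longrightarrow> 0 < A \<Longrightarrow> 0 \<le> phi a A t"
  using phi_mono[of 0 t a A] by simp

text \<open>The mean value theorem on the segment between \<open>s\<close> and \<open>t\<close>,
  with \<open>dphi\<close> monotone. At \<open>t = 0\<close> it reads
  \<open>phi a A s \<le> dphi a A s * s\<close>, a converse to \<open>dphi_le_phi\<close>.\<close>

lemma phi_tangent:
  assumes "0 < s" "0 \<le> t" "1 \<le> a" "1 \<le> A"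
  shows "dphi a A s * (t - s) \<le> phi a A t - phi a A s"
proof -
  consider "t = s" | "s < t" | "t < s" by linarith
  thus ?thesis
  proof cases
    case 2
    obtain z where z: "s < z" "z < t" "phi a A t - phi a A s = dphi a A z * (t - s)"
      using phi_mvt[of s t a A] 2 assms by auto
    show ?thesis unfolding z using z assms
      by (intro mult_right_mono dphi_mono) auto
  next
    case 3
    obtain z where z: "t < z" "z < s" "phi a A s - phi a A t = dphi a A z * (s - t)"
      using phi_mvt[of t s a A] 3 assms by auto
    have "dphi a A z * (s - t) \<le> dphi a A s * (s - t)"
      using z assms by (intro mult_right_mono dphi_mono) auto
    thus ?thesis using z(3) by (simp add: algebra_simps)
  qed simp
qed

lemma phi_strict_tangent:
  assumes "0 < s" "0 \<le> t" "s \<noteq> t" "1 < a" "1 < A"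
  shows "dphi a A s * (t - s) < phi a A t - phi a A s"
proof -
  consider "s < t" | "t < s" using assms by linarith
  thus ?thesis
  proof cases
    case 1
    obtain z where z: "s < z" "z < t" "phi a A t - phi a A s = dphi a A z * (t - s)"
      using phi_mvt[of s t a A] 1 assms by auto
    show ?thesis unfolding z using z assms
      by (intro mult_strict_right_mono dphi_strict_mono) auto
  next
    case 2
    obtain z where z: "t < z" "z < s" "phi a A s - phi a A t = dphi a A z * (s - t)"
      using phi_mvt[of t s a A] 2 assms by auto
    have "dphi a A z * (s - t) < dphi a A s * (s - t)"
      using z assms by (intro mult_strict_right_mono dphi_strict_mono) auto
    thus ?thesis using z(3) by (simp add: algebra_simps)
  qed
qed

text \<open>The tangent inequalities at \<open>z = u * s + v * t\<close> are added with weights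
  \<open>u\<close> and \<open>v\<close>; the slope terms cancel because
  \<open>u * (s - z) + v * (t - z) = 0\<close>.\<close>

lemma phi_convex:
  assumes "0 \<le> s" "0 \<le> t" "0 \<le> u" "0 \<le> v" "u + v = 1" "1 \<le> a" "1 \<le> A"
  shows "phi a A (u * s + v * t) \<le> u * phi a A s + v * phi a A t"
proof (cases "u * s + v * t = 0")
  case True
  thus ?thesis using assms by (simp add: phi_nonneg)
next
  case False
  define z where "z = u * s + v * t"
  have z: "0 < z" using False assms by (simp add: z_def less_le)
  have "u * (dphi a A z * (s - z)) + v * (dphi a A z * (t - z))
      \<le> u * (phi a A s - phi a A z) + v * (phi a A t - phi a A z)"
    using z assms by (intro add_mono mult_left_mono phi_tangent) auto
  moreover have "u * (dphi a A z * (s - z)) + v * (dphi a A z * (t - z)) = dphi a A z * (z - (u + v) * z)"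
    by (simp add: z_def algebra_simps)
  moreover have "u * (phi a A s - phi a A z) + v * (phi a A t - phi a A z)
      = u * phi a A s + v * phi a A t - (u + v) * phi a A z" by (simp add: algebra_simps)
  ultimately show ?thesis using assms(5) by (simp add: z_def)
qed

lemma phi_strict_convex:
  assumes "0 \<le> s" "0 \<le> t" "s \<noteq> t" "0 < u" "0 < v" "u + v = 1" "1 < a" "1 < A"
  shows "phi a A (u * s + v * t) < u * phi a A s + v * phi a A t"
proof -
  define z where "z = u * s + v * t"
  have z: "0 < z"
    using assms by (smt (verit) mult_nonneg_nonneg mult_pos_pos z_def)
  have ne: "z \<noteq> s" "z \<noteq> t"
  proof -
    have u: "u = 1 - v" using assms by simp
    have "z - s = v * (t - s)" "z - t = u * (s - t)" unfolding z_def u by (simp_all add: algebra_simps)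
    thus "z \<noteq> s" "z \<noteq> t" using assms by auto
  qed
  have "u * (dphi a A z * (s - z)) + v * (dphi a A z * (t - z))
      < u * (phi a A s - phi a A z) + v * (phi a A t - phi a A z)"
    using z assms ne by (intro add_strict_mono mult_strict_left_mono phi_strict_tangent) auto
  moreover have "u * (dphi a A z * (s - z)) + v * (dphi a A z * (t - z)) = dphi a A z * (z - (u + v) * z)"
    by (simp add: z_def algebra_simps)
  moreover have "u * (phi a A s - phi a A z) + v * (phi a A t - phi a A z)
      = u * phi a A s + v * phi a A t - (u + v) * phi a A z" by (simp add: algebra_simps)
  ultimately show ?thesis using assms(6) by (simp add: z_def)
qed

section \<open>Growth, Young inequality and halved exponents\<close>

text \<open>The difference of the two sides vanishes at \<open>0\<close> and has derivative
  \<open>(m - 1) * dphi a A t - t * ddphi a A t\<close>, which \<open>ddphi_le\<close> makes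
  nonnegative.\<close>

lemma dphi_le_phi:
  assumes "0 \<le> t" "1 < a" "1 < A"
  shows "dphi a A t * t \<le> max a A * phi a A t"
proof -
  define m where "m = max a A"
  have "0 \<le> m * phi a A t - dphi a A t * t"
  proof (rule nonneg_of_deriv_nonneg[where g = "\<lambda>t. m * phi a A t - dphi a A t * t"
      and g' = "\<lambda>t. m * dphi a A t - (ddphi a A t * t + dphi a A t)"])
    show "continuous_on {0..} (\<lambda>t. m * phi a A t - dphi a A t * t)"
      using assms by (intro continuous_intros phi_cont dphi_cont) auto
    show "((\<lambda>t. m * phi a A t - dphi a A t * t) has_real_derivative
        m * dphi a A x - (ddphi a A x * x + dphi a A x)) (at x)" if "0 < x" for x
      using that assms by (auto intro!: derivative_eq_intros phi_deriv dphi_deriv)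
    show "0 \<le> m * dphi a A x - (ddphi a A x * x + dphi a A x)" if "0 < x" for x
      using ddphi_le(1)[OF that, of a A] by (simp add: m_def algebra_simps)
  qed (use assms in auto)
  thus ?thesis by (simp add: m_def)
qed

text \<open>By \<open>dphi_le_phi\<close> the logarithmic derivative of
  \<open>phi a A (l * t)\<close> in \<open>l\<close> is at most \<open>m / l\<close>, so
  \<open>l powr (- m) * phi a A (l * t)\<close> is non-increasing.\<close>

lemma phi_scale:
  assumes "0 \<le> t" "1 \<le> l" "1 < a" "1 < A"
  shows "phi a A (l * t) \<le> l powr max a A * phi a A t"
proof (cases "t = 0")
  case False
  define m where "m = max a A"
  define h where "h = (\<lambda>l. l powr (- m) * phi a A (l * t))"
  have "h l \<le> h 1"
  proof (rule DERIV_nonpos_imp_nonincreasing[OF assms(2)])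
    fix x :: real assume "1 \<le> x" "x \<le> l"
    hence x: "0 < x" "0 < x * t" using assms False by auto
    have "(h has_real_derivative
       - m * x powr (- m - 1) * phi a A (x * t) + x powr (- m) * (dphi a A (x * t) * t)) (at x)"
      unfolding h_def using x assms
      by (auto intro!: derivative_eq_intros DERIV_chain2[OF phi_deriv])
    moreover have "- m * x powr (- m - 1) * phi a A (x * t) + x powr (- m) * (dphi a A (x * t) * t)
        = x powr (- m - 1) * (dphi a A (x * t) * (x * t) - m * phi a A (x * t))"
      using x(1) by (simp add: powr_diff field_simps)
    moreover have "\<dots> \<le> 0"
      using dphi_le_phi[of "x * t" a A] x assms by (simp add: m_def mult_nonneg_nonpos)
    ultimately show "\<exists>y. (h has_real_derivative y) (at x) \<and> y \<le> 0" by metis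
  qed
  hence "l powr m * (l powr (- m) * phi a A (l * t)) \<le> l powr m * phi a A t"
    unfolding h_def by (intro mult_left_mono) auto
  moreover have "l powr m * l powr (- m) = 1" using assms by (simp add: powr_minus field_simps)
  ultimately show ?thesis by (simp add: m_def mult.assoc[symmetric])
qed simp

text \<open>
  Hoelder's inequality for the vectors \<open>(s, 1)\<close> and \<open>(t, 1)\<close>, followed by Young's inequality for the
  two resulting norms.
\<close>

lemma phi_young:
  assumes "0 \<le> s" "0 \<le> t" "1 < a" "1 < A"
  shows "s * t \<le> phi a A s + phi (a / (a - 1)) (A / (A - 1)) t"
proof -
  define b B where "b = a / (a - 1)" and "B = A / (A - 1)"
  define S T where "S = (s powr a + 1) powr (1 / a)" and "T = (t powr b + 1) powr (1 / b)"
  have b: "1 < b" "1 < B" "1 / a + 1 / b = 1" "1 / A + 1 / B = 1"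
    using assms by (simp_all add: b_def B_def field_simps)
  have 1: "s powr a + 1 > 0" "t powr b + 1 > 0" by (simp_all add: add_nonneg_pos)
  hence ST: "S > 0" "T > 0" by (auto simp: S_def T_def)
  have Sa: "S powr a = s powr a + 1" "T powr b = t powr b + 1"
    using assms b 1 by (simp_all add: S_def T_def powr_powr)
  have "(s / S) * (t / T) + (1 / S) * (1 / T) \<le>
      ((s / S) powr a / a + (t / T) powr b / b) + ((1 / S) powr a / a + (1 / T) powr b / b)"
    using ST assms b by (intro add_mono Youngs_inequality) auto
  also have "\<dots> = (s powr a + 1) / S powr a / a + (t powr b + 1) / T powr b / b"
    using ST assms by (simp add: powr_divide add_divide_distrib)
  also have "\<dots> = 1" using Sa 1 b(3) by simp
  finally have "s * t + 1 \<le> S * T" using ST by (simp add: field_simps)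
  also have "\<dots> \<le> S powr A / A + T powr B / B"
    using ST assms b by (intro Youngs_inequality) auto
  also have "\<dots> = (s powr a + 1) powr (A / a) / A + (t powr b + 1) powr (B / b) / B"
    by (simp add: S_def T_def powr_powr)
  also have "\<dots> = phi a A s + phi b B t + (1 / A + 1 / B)" by (simp add: phi_def)
  finally show ?thesis using b(4) by (simp add: b_def B_def)
qed

text \<open>Halving both exponents and squaring the argument leaves \<open>t powr a\<close> and the
  ratio \<open>A / a\<close> unchanged; only the prefactor \<open>1 / A\<close> doubles. This turns
  quadratic terms \<open>t\<^sup>2\<close> into arguments of a function that is still
  convex.\<close>

lemma phi_double:
  assumes "0 < t" "0 < a"
  shows "phi (a / 2) (A / 2) (t ^ 2) = 2 * phi a A t"
    and "dphi (a / 2) (A / 2) (t ^ 2) = dphi a A t / t"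
proof -
  have e: "(t ^ 2) powr r = t powr (2 * r)" for r
    using assms by (simp add: powr_powr flip: powr_numeral)
  show "phi (a / 2) (A / 2) (t ^ 2) = 2 * phi a A t"
    using assms by (simp add: phi_def e algebra_simps)
  have "2 * (a / 2 - 1) = (a - 1) - 1" by simp
  moreover have "t powr ((a - 1) - 1) = t powr (a - 1) / t"
    using assms powr_diff[of t "a - 1" 1] by simp
  ultimately show "dphi (a / 2) (A / 2) (t ^ 2) = dphi a A t / t"
    by (simp add: dphi_def e)
qed

text \<open>
  The base of the power in \<open>C_const\<close> is the extremal value of \<open>1 - z + z powr p\<close> for
  \<open>p = (A - 1) / (a - 1)\<close>: a minimum if \<open>p > 1\<close>, a maximum if \<open>p < 1\<close>.
\<close>

lemma bernoulli_min:
  fixes p z0 z :: real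
  assumes "p > 1" "0 < z0" "p * z0 powr (p - 1) = 1" "0 < z"
  shows "1 - z0 + z0 powr p \<le> 1 - z + z powr p"
proof -
  have q: "1 < p / (p - 1)" "1 / p + 1 / (p / (p - 1)) = 1" using assms by (auto simp: field_simps)
  \<comment> \<open>The hypothesis on \<open>z0\<close> says that the derivative
    \<open>p * z powr (p - 1) - 1\<close> vanishes there. Young's inequality with exponents
    \<open>p\<close> and \<open>p / (p - 1)\<close> is an equality at \<open>z = z0\<close>.\<close>
  have "z * z0 powr (p - 1) \<le> z powr p / p + (z0 powr (p - 1)) powr (p / (p - 1)) / (p / (p - 1))"
    using assms q by (intro Youngs_inequality) auto
  also have "(z0 powr (p - 1)) powr (p / (p - 1)) = z0 powr p"
    using assms by (simp add: powr_powr)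
  finally have "p * (z * z0 powr (p - 1)) \<le> p * (z powr p / p + z0 powr p / (p / (p - 1)))"
    using assms by (intro mult_left_mono) auto
  also have "\<dots> = z powr p + (p - 1) * z0 powr p" using assms by (simp add: field_simps)
  finally have "(p * z0 powr (p - 1)) * z \<le> z powr p + (p - 1) * z0 powr p" by (simp add: mult_ac)
  moreover have "(p * z0 powr (p - 1)) * z0 = p * z0 powr p"
    using assms by (simp add: powr_diff)
  ultimately show ?thesis using assms by (simp add: algebra_simps)
qed

lemma bernoulli_max:
  fixes p z0 z :: real
  assumes "0 < p" "p < 1" "0 < z0" "p * z0 powr (p - 1) = 1" "0 < z"
  shows "1 - z + z powr p \<le> 1 - z0 + z0 powr p"
proof -
  \<comment> \<open>Weighted arithmetic-geometric mean inequality with weights \<open>p\<close> and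
    \<open>1 - p\<close>, again sharp at \<open>z = z0\<close>.\<close>
  have "z powr p * z0 powr (1 - p) \<le> p * z + (1 - p) * z0"
    using assms by (intro Youngs_inequality_0) auto
  moreover have e: "z0 powr (1 - p) = p" "z0 powr p = z0 / p"
    using assms by (auto simp: powr_diff field_simps)
  ultimately have "z powr p * p \<le> (z + z0 / p - z0) * p" using assms by (simp add: algebra_simps)
  hence "z powr p \<le> z + z0 / p - z0" using assms by simp
  thus ?thesis using e by simp
qed

text \<open>The exponent \<open>B / b - 1\<close> has the sign of \<open>a - A\<close>. So for
  \<open>p > 1\<close> it is negative and the minimum of the base bounds the power from above; for
  \<open>p < 1\<close> it is positive and the maximum does.\<close>

lemma C_const_bound:
  assumes "1 < a" "1 < A" "0 < z" "z \<le> 1"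
  defines "b \<equiv> a / (a - 1)" and "B \<equiv> A / (A - 1)" and "p \<equiv> (A - 1) / (a - 1)"
  shows "(1 - z + z powr p) powr (B / b - 1) \<le> C_const a A"
proof (cases "a = A")
  case True
  thus ?thesis using assms by (simp add: C_const_def p_def)
next
  case False
  \<comment> \<open>The solution of \<open>p * z0 powr (p - 1) = 1\<close>, since the base is
    \<open>1 / p\<close> and the exponent \<open>1 / (p - 1)\<close>.\<close>
  define z0 where "z0 = ((a - 1) / (A - 1)) powr ((a - 1) / (A - a))"
  have pp: "0 < p" "p \<noteq> 1" using assms False by (auto simp: p_def)
  have b: "b > 0" using assms by (simp add: b_def)
  have r: "(a - 1) / (A - 1) = 1 / p" by (simp add: p_def)
  have z0: "0 < z0" using assms by (simp add: z0_def)
  have "p - 1 = (A - a) / (a - 1)" using assms by (simp add: p_def field_simps)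
  hence ex: "(a - 1) / (A - a) * (p - 1) = 1" using assms False by simp
  have "z0 powr (p - 1) = (1 / p) powr ((a - 1) / (A - a) * (p - 1))"
    by (simp only: z0_def powr_powr r)
  hence z0p1: "p * z0 powr (p - 1) = 1" unfolding ex using pp by simp
  have z0p: "z0 powr p = ((a - 1) / (A - 1)) powr ((A - 1) / (A - a))"
    using assms by (simp add: z0_def powr_powr p_def)
  have C: "C_const a A = (1 - z0 + z0 powr p) powr ((B - b) / b)"
    unfolding z0p unfolding z0_def using False by (simp add: C_const_def b_def B_def Let_def)
  have e: "B / b - 1 = (B - b) / b" using b by (simp add: diff_divide_distrib)
  have Bb: "B - b = (a - A) / ((a - 1) * (A - 1))"
    using assms(1,2) by (simp add: b_def B_def field_simps)
  show ?thesis
  proof (cases "p > 1")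
    case True
    hence "a < A" using assms by (simp add: p_def)
    hence "B - b < 0" unfolding Bb using assms(1,2) by (intro divide_neg_pos mult_pos_pos) auto
    hence neg: "(B - b) / b \<le> 0" using b by (simp add: divide_nonpos_pos)
    \<comment> \<open>Needed for the base at \<open>z0\<close> to be positive, since a power with a
      nonpositive exponent decreases only on positive bases.\<close>
    have "z0 \<le> 1"
    proof (rule ccontr)
      assume "\<not> z0 \<le> 1"
      hence "1 powr (p - 1) \<le> z0 powr (p - 1)" using True by (intro powr_mono2) auto
      hence "p * 1 \<le> p * z0 powr (p - 1)" using pp by (intro mult_left_mono) auto
      thus False using z0p1 True by simp
    qed
    hence "0 < 1 - z0 + z0 powr p" using z0 by (simp add: add_nonneg_pos)
    thus ?thesis unfolding C e
      using bernoulli_min[OF True z0 z0p1 assms(3)] neg by (intro powr_mono2')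
  next
    case F: False
    hence "p < 1" using pp by simp
    hence "A < a" using assms by (simp add: p_def)
    hence "B - b > 0" unfolding Bb using assms(1,2) by (intro divide_pos_pos mult_pos_pos) auto
    hence "(B - b) / b \<ge> 0" using b by simp
    thus ?thesis unfolding C e
      using bernoulli_max[OF pp(1) \<open>p < 1\<close> z0 z0p1 assms(3)] assms by (intro powr_mono2) auto
  qed
qed

text \<open>The two derivatives are inverse to each other up to a factor, which is 1 if
  \<open>a = A\<close>. With \<open>w = s powr a + 1\<close>, the quantity
  \<open>dphi a A s powr b + 1\<close> equals
  \<open>(w - 1) * w powr (p - 1) + 1 = w powr p * Y\<close>, and the remaining powers of
  \<open>w\<close> cancel.\<close>

lemma dphi_dphi:
  assumes "1 < a" "1 < A" "0 < s"
  defines "b \<equiv> a / (a - 1)" and "B \<equiv> A / (A - 1)" and "p \<equiv> (A - 1) / (a - 1)"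
    and "z \<equiv> 1 / (s powr a + 1)"
  shows "dphi b B (dphi a A s) = s * (1 - z + z powr p) powr (B / b - 1)"
proof -
  define w Y e where "w = s powr a + 1" and "Y = 1 - z + z powr p" and "e = (A - a) / (a * (a - 1))"
  have w: "1 < w" "z = 1 / w" using assms by (auto simp: w_def)
  have z: "0 < z" "z < 1" using w by auto
  have Y: "0 < Y" using z by (simp add: Y_def add_pos_pos)
  have d: "dphi a A s = s powr (a - 1) * w powr (A / a - 1)" by (simp add: dphi_def w_def)
  have b: "(a - 1) * (b - 1) = 1" "(a - 1) * b = a" "(A / a - 1) * (b - 1) = e"
      "(A / a - 1) * b = p - 1"
    using assms by (simp_all add: b_def e_def p_def field_simps)
  have "p * (B / b) = A / a"
    using assms by (simp add: b_def B_def p_def)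
  hence "p * (B / b - 1) = A / a - p" by (simp add: right_diff_distrib)
  also have "\<dots> = - e"
    using assms by (simp add: p_def e_def field_simps)
  finally have B: "p * (B / b - 1) = - e" .
  have 1: "dphi a A s powr (b - 1) = s * w powr e"
    using assms(3) w by (simp add: d powr_mult powr_powr b)
  have "dphi a A s powr b + 1 = s powr a * w powr (p - 1) + 1"
    using assms(3) w by (simp add: d powr_mult powr_powr b)
  also have "\<dots> = (w - 1) * w powr (p - 1) + 1" by (simp add: w_def)
  also have "\<dots> = w powr p * Y"
  proof -
    have 1: "w powr p * z powr p = 1" using w by (simp flip: powr_mult)
    have 2: "w powr (p - 1) = w powr p * z" using w by (simp add: powr_diff)
    have 3: "w * z = 1" using w by simp
    have "(w - 1) * w powr (p - 1) + 1 = w powr p * (w * z) - w powr p * z + w powr p * z powr p"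
      unfolding 1 2 by (simp add: algebra_simps)
    thus ?thesis unfolding 3 by (simp add: Y_def algebra_simps)
  qed
  finally have "(dphi a A s powr b + 1) powr (B / b - 1) = w powr (- e) * Y powr (B / b - 1)"
    using w Y by (simp add: powr_mult powr_powr B)
  thus ?thesis
    unfolding dphi_def[of b B] 1 Y_def[symmetric] using w by (simp add: powr_minus field_simps)
qed

text \<open>
  Since the derivative of \<open>s * dphi a A s - phi a A s\<close> is \<open>s * ddphi a A s\<close>, the bound
  \<open>dphi b B (dphi a A s) \<le> s * C_const a A\<close> integrates to
  \<open>phi b B (dphi a A s) \<le> C_const a A * (s * dphi a A s - phi a A s)\<close>.
\<close>

lemma phi_dphi_le:
  assumes "1 < a" "1 < A" "0 \<le> s"
  defines "b \<equiv> a / (a - 1)" and "B \<equiv> A / (A - 1)"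
  shows "phi b B (dphi a A s) \<le> C_const a A * (max a A - 1) * phi a A s"
proof -
  define C where "C = C_const a A"
  have b: "1 < b" "1 < B" using assms by (simp_all add: b_def B_def)
  have le: "dphi b B (dphi a A x) \<le> x * C" if "0 < x" for x
    using that assms C_const_bound[of a A "1 / (x powr a + 1)"] unfolding b_def B_def C_def
    by (subst dphi_dphi) (auto intro!: mult_left_mono simp: add_nonneg_pos)
  have C0: "0 \<le> C" using le[of 1] dphi_nonneg[OF dphi_nonneg, of 1 b B a A] by simp
  have "0 \<le> C * (dphi a A s * s - phi a A s) - phi b B (dphi a A s)"
  proof (rule nonneg_of_deriv_nonneg[where g = "\<lambda>s. C * (dphi a A s * s - phi a A s) - phi b B (dphi a A s)"
      and g' = "\<lambda>x. (C * x - dphi b B (dphi a A x)) * ddphi a A x"])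
    show "continuous_on {0..} (\<lambda>s. C * (dphi a A s * s - phi a A s) - phi b B (dphi a A s))"
      using assms b
      by (intro continuous_intros phi_cont dphi_cont continuous_on_compose2[OF phi_cont[of b B]])
         (auto simp: dphi_nonneg)
    show "((\<lambda>s. C * (dphi a A s * s - phi a A s) - phi b B (dphi a A s)) has_real_derivative
        (C * x - dphi b B (dphi a A x)) * ddphi a A x) (at x)" if "0 < x" for x
    proof -
      have c: "((\<lambda>x. phi b B (dphi a A x)) has_real_derivative
          dphi b B (dphi a A x) * ddphi a A x) (at x)"
        using that assms(1,2) b dphi_pos[OF that, of a A]
        by (intro DERIV_chain2[OF phi_deriv dphi_deriv]) auto
      show ?thesis
        using that assms(1,2)
        by (auto intro!: derivative_eq_intros phi_deriv dphi_deriv c simp: algebra_simps)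
    qed
    show "0 \<le> (C * x - dphi b B (dphi a A x)) * ddphi a A x" if "0 < x" for x
      using le[OF that] ddphi_nonneg[OF that, of a A] assms by (simp add: mult.commute)
  qed (use assms in auto)
  \<comment> \<open>Replacing \<open>dphi a A s * s\<close> by \<open>max a A * phi a A s\<close>
    produces the factor \<open>max a A - 1\<close>; this uses \<open>0 \<le> C\<close>.\<close>
  also have "C * (dphi a A s * s - phi a A s) \<le> C * (max a A * phi a A s - phi a A s)"
    using dphi_le_phi[of s a A] C0 assms by (intro mult_left_mono) auto
  finally show ?thesis by (simp add: C_def algebra_simps)
qed

section \<open>Scalar inequalities behind condition (D)\<close>

text \<open>The scalar form of the inequality with \<open>E_k = m - 1\<close> and
  \<open>F_k = 1\<close>. For \<open>s \<le> t\<close> monotonicity suffices, and for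
  \<open>t = 0\<close> the tangent at \<open>s\<close> does; the case \<open>0 < t < s\<close>
  compares derivatives in \<open>s\<close>.\<close>

lemma phi_monotone_bound:
  assumes "2 \<le> a" "2 \<le> A" "0 \<le> s" "0 \<le> t"
  shows "phi a A s \<le> max a A * phi a A t + (dphi a A s - dphi a A t) * (s - t)"
proof -
  define m where "m = max a A"
  have m: "2 \<le> m" using assms by (auto simp: m_def)
  have nn: "0 \<le> phi a A t" using assms by (intro phi_nonneg) auto
  consider "s \<le> t" "s = 0" | "0 < s" "s \<le> t" | "t = 0" "0 < s" | "0 < t" "t < s"
    using assms by fastforce
  thus ?thesis
  proof cases
    case 1
    thus ?thesis using assms nn dphi_nonneg[of t a A] m
      by (simp add: m_def[symmetric])
  next
    case 2
    have "(dphi a A t - dphi a A s) * (t - s) \<ge> 0"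
      using 2 dphi_mono[of s t a A] assms by simp
    moreover have "phi a A s \<le> 1 * phi a A t" using 2 assms by (simp add: phi_mono)
    moreover have "1 * phi a A t \<le> m * phi a A t" using m nn by (intro mult_right_mono) auto
    ultimately show ?thesis by (simp add: m_def algebra_simps)
  next
    case 3
    thus ?thesis using phi_tangent[of s 0 a A] assms by simp
  next
    case 4
    define d where "d = dphi a A t"
    \<comment> \<open>The derivative of the first two terms is at least \<open>d * (s - 2 * t) / t\<close>, which is what the
      last term subtracts.\<close>
    define D where "D = (\<lambda>s. (dphi a A s - d) * (s - t) - phi a A s - d * (s - 2 * t)\<^sup>2 / (2 * t))"
    have "D t \<le> D s"
    proof (rule DERIV_nonneg_imp_nondecreasing[where f = D])
      show "t \<le> s" using 4 by simp
      fix x assume x: "t \<le> x" "x \<le> s"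
      hence x0: "0 < x" using 4 by simp
      have "(D has_real_derivative ddphi a A x * (x - t) - d - d * (x - 2 * t) / t) (at x)"
        unfolding D_def using x0 4 assms
        by (auto intro!: derivative_eq_intros phi_deriv dphi_deriv simp: field_simps)
      moreover have "ddphi a A x * (x - t) - d - d * (x - 2 * t) / t = (ddphi a A x - d / t) * (x - t)"
        using 4 by (simp add: field_simps)
      \<comment> \<open>\<open>dphi a A x / x\<close> is the slope of the convex function
        \<open>phi (a / 2) (A / 2)\<close> at the square of \<open>x\<close>, hence nondecreasing;
        and \<open>x * ddphi a A x\<close> dominates \<open>dphi a A x\<close> because
        \<open>min a A - 1\<close> is at least 1.\<close>
      moreover have "d / t \<le> ddphi a A x"
      proof -
        have th: "d / t = dphi (a / 2) (A / 2) (t ^ 2)" "dphi a A x / x = dphi (a / 2) (A / 2) (x ^ 2)"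
          using phi_double(2)[of t a A] phi_double(2)[of x a A] 4 x0 assms by (auto simp: d_def)
        have "d / t \<le> dphi a A x / x"
          unfolding th using 4 x assms by (intro dphi_mono power_mono) auto
        also have "dphi a A x \<le> (min a A - 1) * dphi a A x"
          using dphi_nonneg[of x a A] x0 assms by (intro mult_le_cancel_right1[THEN iffD2]) auto
        also have "\<dots> \<le> x * ddphi a A x" using ddphi_le(2)[OF x0] .
        finally show ?thesis using x0 by (simp add: divide_right_mono)
      qed
      ultimately show "\<exists>y. (D has_real_derivative y) (at x) \<and> 0 \<le> y"
        using x by (intro exI[of _ "(ddphi a A x - d / t) * (x - t)"]) auto
    qed
    \<comment> \<open>Once the square in \<open>D s\<close> is dropped, the loss is
      \<open>phi a A t + d * t / 2\<close>, and each summand is at most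
      \<open>m / 2 * phi a A t\<close>.\<close>
    moreover have "D t = - phi a A t - d * t / 2"
      using 4 by (simp add: D_def power2_eq_square field_simps)
    moreover have "0 \<le> d * (s - 2 * t)\<^sup>2 / (2 * t)"
      using 4 dphi_nonneg[of t a A] by (simp add: d_def)
    moreover have "d * t \<le> m * phi a A t"
      unfolding d_def m_def using 4 assms by (intro dphi_le_phi) auto
    moreover have "2 * phi a A t \<le> m * phi a A t"
      using m nn by (intro mult_right_mono) auto
    ultimately show ?thesis
      unfolding D_def d_def[symmetric] m_def[symmetric] by linarith
  qed
qed

text \<open>\<open>dphi a A s / s\<close> is the slope of the convex function \<open>phi (a / 2) (A / 2)\<close> at \<open>s\<^sup>2\<close>.\<close>

lemma phi_square_bound:
  assumes "2 \<le> a" "2 \<le> A" "0 < s" "0 \<le> t"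
  shows "dphi a A s / s * t\<^sup>2 \<le> 2 * phi a A t + (max a A - 2) * phi a A s"
proof -
  have t: "phi (a / 2) (A / 2) (t\<^sup>2) = 2 * phi a A t"
    using phi_double(1)[of t a A] assms by (cases "t = 0") auto
  have "dphi (a / 2) (A / 2) (s\<^sup>2) * (t\<^sup>2 - s\<^sup>2)
      \<le> phi (a / 2) (A / 2) (t\<^sup>2) - phi (a / 2) (A / 2) (s\<^sup>2)"
    using assms by (intro phi_tangent) auto
  hence "dphi a A s / s * (t\<^sup>2 - s\<^sup>2) \<le> 2 * phi a A t - 2 * phi a A s"
    using phi_double[of s a A] assms t by simp
  \<comment> \<open>The part not covered by the tangent costs \<open>max a A * phi a A s\<close>, of
    which the tangent inequality has already paid \<open>2 * phi a A s\<close>.\<close>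
  moreover have "dphi a A s / s * s\<^sup>2 = dphi a A s * s"
    using assms by (simp add: power2_eq_square)
  moreover have "dphi a A s * s \<le> max a A * phi a A s"
    using assms by (intro dphi_le_phi) auto
  ultimately show ?thesis by (simp add: algebra_simps)
qed

section \<open>Norms and their gradients\<close>

lemma is_normD:
  assumes "is_norm N"
  shows is_norm_eq_0: "N x = 0 \<longleftrightarrow> x = 0"
    and is_norm_scale: "N (c *\<^sub>R x) = \<bar>c\<bar> * N x"
    and is_norm_triangle: "N (x + y) \<le> N x + N y"
    and is_norm_minus: "N (- x) = N x"
    and is_norm_nonneg: "0 \<le> N x"
proof -
  show 0: "N x = 0 \<longleftrightarrow> x = 0" "N (c *\<^sub>R x) = \<bar>c\<bar> * N x" "N (x + y) \<le> N x + N y" for x y c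
    using assms by (auto simp: is_norm_def)
  show 1: "N (- x) = N x" using 0(2)[of "-1" x] by simp
  show "0 \<le> N x" using 0(3)[of x "- x"] 1 0(1)[of 0] by simp
qed

lemma is_norm_pos: "is_norm N \<Longrightarrow> x \<noteq> 0 \<Longrightarrow> 0 < N x"
  using is_norm_nonneg[of N x] is_norm_eq_0[of N x] by linarith

lemma is_norm_convex:
  assumes "is_norm N" "0 \<le> u" "0 \<le> v"
  shows "N (u *\<^sub>R x + v *\<^sub>R y) \<le> u * N x + v * N y"
  using is_norm_triangle[OF assms(1), of "u *\<^sub>R x" "v *\<^sub>R y"] assms
  by (simp add: is_norm_scale)

lemma is_norm_continuous:
  assumes "is_norm N"
  shows "continuous_on S N"
proof -
  have "convex_on UNIV N"
    using is_norm_convex[OF assms] by (intro convex_onI) auto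
  hence "continuous_on UNIV N" by (intro convex_on_continuous) auto
  thus ?thesis by (rule continuous_on_subset) auto
qed

text \<open>The minimum over the compact Euclidean sphere is positive, and homogeneity extends the
  bound. It makes the unit sphere of \<open>N\<close> bounded.\<close>

lemma is_norm_lower:
  assumes "is_norm N"
  obtains c where "0 < c" "\<And>x. c * norm x \<le> N x"
proof -
  have "sphere 0 1 \<noteq> ({} :: (real^'a) set)" by simp
  then obtain e :: "real^'a" where e: "norm e = 1" "\<And>x. norm x = 1 \<Longrightarrow> N e \<le> N x"
    using continuous_attains_inf[OF compact_sphere _ is_norm_continuous[OF assms], of 0 1] by auto
  have "N e * norm x \<le> N x" for x
  proof (cases "x = 0")
    case False
    have "N e * norm x \<le> N ((1 / norm x) *\<^sub>R x) * norm x"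
      using False e(2)[of "(1 / norm x) *\<^sub>R x"] by (intro mult_right_mono) auto
    thus ?thesis using False by (simp only: is_norm_scale[OF assms]) simp
  qed (simp add: is_norm_nonneg[OF assms])
  moreover have "0 < N e" using e(1) by (intro is_norm_pos[OF assms]) auto
  ultimately show ?thesis using that by blast
qed

lemma is_norm_upper:
  assumes "is_norm N"
  obtains K where "0 \<le> K" "\<And>x. N x \<le> K * norm x"
proof -
  have "sphere 0 1 \<noteq> ({} :: (real^'a) set)" by simp
  then obtain e :: "real^'a" where e: "norm e = 1" "\<And>x. norm x = 1 \<Longrightarrow> N x \<le> N e"
    using continuous_attains_sup[OF compact_sphere _ is_norm_continuous[OF assms], of 0 1] by auto
  have "N x \<le> N e * norm x" for x
  proof (cases "x = 0")
    case False
    have "N ((1 / norm x) *\<^sub>R x) * norm x \<le> N e * norm x"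
      using False e(2)[of "(1 / norm x) *\<^sub>R x"] by (intro mult_right_mono) auto
    thus ?thesis using False by (simp only: is_norm_scale[OF assms]) simp
  next
    case True
    thus ?thesis using is_norm_eq_0[OF assms, of 0] by simp
  qed
  thus ?thesis using that is_norm_nonneg[OF assms] by blast
qed

lemma compact_unit_sphere:
  assumes "is_norm N"
  shows "compact {v. N v = 1}"
proof -
  obtain c where c: "0 < c" "\<And>x. c * norm x \<le> N x" using is_norm_lower[OF assms] by blast
  have "norm x \<le> 1 / c" if "N x = 1" for x
    using c(1) c(2)[of x] that by (simp add: field_simps)
  hence "bounded {v. N v = 1}" by (auto simp: bounded_iff)
  moreover have "closed {v. N v = 1}"
    using is_norm_continuous[OF assms] by (intro closed_Collect_eq) auto
  ultimately show ?thesis by (simp add: compact_eq_bounded_closed)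
qed

text \<open>\<open>dual_norm\<close> and \<open>lambda_max\<close> are real suprema, which dominate
  the individual values only if the set is bounded above.\<close>

lemma bdd_above_unit_sphere:
  fixes h :: "real^'d \<Rightarrow> real"
  assumes "is_norm N" "continuous_on UNIV h"
  shows "bdd_above (h ` {v. N v = 1})"
proof -
  have "continuous_on {v. N v = 1} h" using assms(2) by (rule continuous_on_subset) auto
  thus ?thesis
    by (intro bounded_imp_bdd_above compact_imp_bounded compact_continuous_image
        compact_unit_sphere assms)
qed

lemma unit_sphere_normalize:
  assumes "is_norm N" "x \<noteq> 0"
  shows "N ((1 / N x) *\<^sub>R x) = 1" "x = N x *\<^sub>R ((1 / N x) *\<^sub>R x)"
  using is_norm_pos[OF assms] by (simp_all add: is_norm_scale[OF assms(1)])

lemma unit_sphere_nonempty: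
  assumes "is_norm (N :: real^'d \<Rightarrow> real)"
  shows "{v. N v = 1} \<noteq> {}"
proof -
  have "axis undefined 1 \<noteq> (0 :: real^'d)" by (simp add: axis_eq_0_iff)
  thus ?thesis using unit_sphere_normalize(1)[OF assms] by blast
qed

lemma inner_le_dual_norm:
  assumes "is_norm N"
  shows "x \<bullet> p \<le> dual_norm N x * N p"
proof (cases "p = 0")
  case True
  thus ?thesis using is_norm_eq_0[OF assms, of 0] by simp
next
  case False
  have "x \<bullet> ((1 / N p) *\<^sub>R p) \<le> dual_norm N x"
    unfolding dual_norm_def using unit_sphere_normalize(1)[OF assms False]
    by (intro cSUP_upper bdd_above_unit_sphere[OF assms] continuous_intros) auto
  thus ?thesis using is_norm_pos[OF assms False] by (simp add: field_simps)
qed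

lemma dual_norm_le:
  assumes "is_norm N" "\<And>p. N p = 1 \<Longrightarrow> x \<bullet> p \<le> K"
  shows "dual_norm N x \<le> K"
  unfolding dual_norm_def using unit_sphere_nonempty[OF assms(1)] assms(2)
  by (intro cSUP_least) auto

lemma is_norm_dual_norm:
  assumes "is_norm N"
  shows "is_norm (dual_norm N)"
proof -
  have z: "dual_norm N 0 = 0"
    unfolding dual_norm_def using unit_sphere_nonempty[OF assms] by simp
  have nn: "0 \<le> dual_norm N x" for x
  proof (cases "x = 0")
    case False
    have "0 < dual_norm N x * N x"
      using inner_le_dual_norm[OF assms, of x x] False
      by (meson inner_gt_zero_iff order_less_le_trans)
    thus ?thesis using is_norm_pos[OF assms False] by (simp add: zero_less_mult_iff)
  qed (simp add: z)
  have sc: "dual_norm N (c *\<^sub>R x) \<le> \<bar>c\<bar> * dual_norm N x" for c x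
  proof (rule dual_norm_le[OF assms])
    fix p assume p: "N p = 1"
    \<comment> \<open>The sign of \<open>c\<close> moves to \<open>p\<close>, which leaves
      \<open>N p\<close> unchanged or makes it zero.\<close>
    have "c *\<^sub>R x \<bullet> p = \<bar>c\<bar> * (x \<bullet> (sgn c *\<^sub>R p))"
      by (simp add: sgn_if)
    also have "\<dots> \<le> \<bar>c\<bar> * (dual_norm N x * N (sgn c *\<^sub>R p))"
      by (intro mult_left_mono inner_le_dual_norm assms) auto
    also have "\<dots> \<le> \<bar>c\<bar> * dual_norm N x"
      using p nn[of x] by (simp add: is_norm_scale[OF assms] sgn_if)
    finally show "c *\<^sub>R x \<bullet> p \<le> \<bar>c\<bar> * dual_norm N x" .
  qed
  have sc': "dual_norm N (c *\<^sub>R x) = \<bar>c\<bar> * dual_norm N x" for c x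
  proof (cases "c = 0")
    case False
    \<comment> \<open>The reverse inequality is \<open>sc\<close> applied to the scalar
      \<open>inverse c\<close>.\<close>
    have "dual_norm N x \<le> \<bar>inverse c\<bar> * dual_norm N (c *\<^sub>R x)"
      using sc[of "inverse c" "c *\<^sub>R x"] False by simp
    hence "\<bar>c\<bar> * dual_norm N x \<le> \<bar>c\<bar> * (\<bar>inverse c\<bar> * dual_norm N (c *\<^sub>R x))"
      by (intro mult_left_mono) auto
    also have "\<dots> = dual_norm N (c *\<^sub>R x)" using False by (simp add: abs_inverse)
    finally show ?thesis using sc[of c x] by simp
  qed (simp add: z)
  have tri: "dual_norm N (x + y) \<le> dual_norm N x + dual_norm N y" for x y
  proof (rule dual_norm_le[OF assms])
    fix p assume "N p = 1"
    thus "(x + y) \<bullet> p \<le> dual_norm N x + dual_norm N y"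
      using inner_le_dual_norm[OF assms, of x p] inner_le_dual_norm[OF assms, of y p]
      by (simp add: inner_add_left)
  qed
  have "x = 0" if "dual_norm N x = 0" for x
    using inner_le_dual_norm[OF assms, of x x] that
    by (metis inner_eq_zero_iff inner_ge_zero mult_zero_left order_antisym)
  thus ?thesis unfolding is_norm_def using z sc' tri by blast
qed

lemma quadratic_form_le_lambda_max:
  assumes "is_norm N"
  shows "v \<bullet> (M *v v) \<le> lambda_max N M * (N v)\<^sup>2"
proof (cases "v = 0")
  case True
  thus ?thesis using is_norm_eq_0[OF assms, of 0] by simp
next
  case False
  define w where "w = (1 / N v) *\<^sub>R v"
  have w: "N w = 1" "v = N v *\<^sub>R w"
    unfolding w_def using unit_sphere_normalize[OF assms False] by auto
  have "continuous_on UNIV (\<lambda>v. v \<bullet> (M *v v))"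
    by (intro continuous_intros linear_continuous_on matrix_vector_mul_bounded_linear)
  hence "w \<bullet> (M *v w) \<le> lambda_max N M"
    unfolding lambda_max_def using w(1)
    by (intro cSUP_upper bdd_above_unit_sphere[OF assms]) auto
  hence "w \<bullet> (M *v w) * (N v)\<^sup>2 \<le> lambda_max N M * (N v)\<^sup>2" by (intro mult_right_mono) auto
  moreover have "v \<bullet> (M *v v) = w \<bullet> (M *v w) * (N v)\<^sup>2"
    by (subst (1 2) w(2)) (simp add: matrix_vector_mult_scaleR power2_eq_square)
  ultimately show ?thesis by simp
qed

text \<open>\<open>strictly_convex_norm\<close> speaks only of midpoints of unit vectors. After
  scaling to unit vectors, and with \<open>u \<le> v\<close> by symmetry, the combination splits
  into \<open>u\<close> times a sum and a remainder along the second vector; the sum gives the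
  strictness.\<close>

lemma strictly_convex_normD:
  assumes "is_norm N" "strictly_convex_norm N" "N x = N y" "x \<noteq> y" "0 < u" "0 < v" "u + v = 1"
  shows "N (u *\<^sub>R x + v *\<^sub>R y) < N x"
  using assms(3-)
proof (induction u v arbitrary: x y rule: linorder_wlog)
  case (sym u v)
  thus ?case using sym(1)[of y x] by (simp add: add.commute)
next
  case (le u v)
  define r where "r = N x"
  have r: "0 < r"
    using le is_norm_pos[OF assms(1), of x] is_norm_pos[OF assms(1), of y]
    unfolding r_def by (cases "x = 0") auto
  define x' y' where "x' = (1 / r) *\<^sub>R x" and "y' = (1 / r) *\<^sub>R y"
  have xy: "x = r *\<^sub>R x'" "y = r *\<^sub>R y'" using r by (simp_all add: x'_def y'_def)
  have n: "N x' = 1" "N y' = 1"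
    using r le by (simp_all add: x'_def y'_def is_norm_scale[OF assms(1)] r_def)
  have "N (x' + y') < 2"
    using assms(2) n le(3) xy unfolding strictly_convex_norm_def by blast
  have v: "v = u + (1 - 2 * u)" using le by simp
  have "u *\<^sub>R x + v *\<^sub>R y = r *\<^sub>R (u *\<^sub>R x' + v *\<^sub>R y')"
    unfolding xy by (simp add: scaleR_add_right mult.commute)
  also have "u *\<^sub>R x' + v *\<^sub>R y' = u *\<^sub>R (x' + y') + (1 - 2 * u) *\<^sub>R y'"
    unfolding v by (simp only: scaleR_add_right scaleR_add_left add.assoc)
  finally have "u *\<^sub>R x + v *\<^sub>R y = r *\<^sub>R (u *\<^sub>R (x' + y') + (1 - 2 * u) *\<^sub>R y')" .
  hence "N (u *\<^sub>R x + v *\<^sub>R y) = r * N (u *\<^sub>R (x' + y') + (1 - 2 * u) *\<^sub>R y')"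
    using r by (simp add: is_norm_scale[OF assms(1)])
  also have "\<dots> \<le> r * (u * N (x' + y') + (1 - 2 * u) * N y')"
    using r le by (intro mult_left_mono is_norm_convex[OF assms(1)]) auto
  also have "\<dots> < r * (u * 2 + (1 - 2 * u) * 1)"
    using r le n \<open>N (x' + y') < 2\<close> by (intro mult_strict_left_mono add_less_le_mono) auto
  finally show ?case using r_def by simp
qed

section \<open>Gradients and Hessians of norms and of \<open>phi a A\<close> composed with
  them\<close>

lemma gderiv_unique: "GDERIV f x :> D \<Longrightarrow> GDERIV f x :> E \<Longrightarrow> D = E"
  unfolding gderiv_def by (metis (mono_tags) has_derivative_unique[THEN fun_cong] vector_eq_ldot)

lemma grad_eqI: "GDERIV f x :> D \<Longrightarrow> grad f x = D"
  unfolding grad_def using gderiv_unique by blast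

text \<open>The derivative is a linear functional, represented by the vector of its values on the
  standard basis.\<close>

lemma gderiv_grad:
  assumes "f differentiable (at x)"
  shows "GDERIV f x :> grad f x"
proof -
  obtain f' where f': "(f has_derivative f') (at x)" using assms by (auto simp: differentiable_def)
  interpret linear f' using f' by (rule has_derivative_linear)
  define D where "D = (\<chi> i. f' (axis i 1))"
  have "f' h = h \<bullet> D" for h
  proof -
    have "f' h = f' (\<Sum>i\<in>UNIV. (h $ i) *\<^sub>R axis i 1)"
      by (simp only: basis_expansion flip: scalar_mult_eq_scaleR)
    also have "\<dots> = h \<bullet> D" by (simp add: sum scale D_def inner_vec_def)
    finally show ?thesis .
  qed
  hence "f' = (\<lambda>h. h \<bullet> D)" by blast
  hence "GDERIV f x :> D" using f' unfolding gderiv_def by simp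
  thus ?thesis using grad_eqI by metis
qed

lemma gderiv_line:
  assumes "GDERIV f p :> n"
  shows "((\<lambda>t. f (p + t *\<^sub>R g)) has_real_derivative n \<bullet> g) (at 0)"
proof -
  have "(f has_derivative (\<lambda>h. h \<bullet> n)) (at (p + 0 *\<^sub>R g))" using assms by (simp add: gderiv_def)
  moreover have "((\<lambda>t. p + t *\<^sub>R g) has_derivative (\<lambda>t. t *\<^sub>R g)) (at 0)"
    by (auto intro!: derivative_eq_intros)
  ultimately have "((\<lambda>t. f (p + t *\<^sub>R g)) has_derivative (\<lambda>t. (t *\<^sub>R g) \<bullet> n)) (at 0)"
    using has_derivative_compose by fastforce
  thus ?thesis unfolding has_field_derivative_def by (simp add: inner_commute mult_commute_abs)
qed

text \<open>The triangle inequality bounds the growth of \<open>N\<close> along \<open>g\<close> by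
  \<open>t * N g\<close>. A larger directional derivative would make
  \<open>N (p + t g) - t * N g\<close> exceed \<open>N p\<close> for small positive
  \<open>t\<close>.\<close>

lemma norm_grad_inner_le:
  assumes "is_norm N" "N differentiable (at p)"
  shows "\<bar>grad N p \<bullet> g\<bar> \<le> N g"
proof -
  have le: "grad N p \<bullet> g \<le> N g" for g
  proof (rule ccontr)
    assume "\<not> grad N p \<bullet> g \<le> N g"
    hence pos: "0 < grad N p \<bullet> g - N g" by simp
    have "((\<lambda>t. N (p + t *\<^sub>R g) - t * N g) has_real_derivative grad N p \<bullet> g - N g) (at 0)"
      using gderiv_line[OF gderiv_grad[OF assms(2)], of g]
      by (auto intro!: derivative_eq_intros)
    from DERIV_pos_inc_right[OF this pos]
    obtain d where d: "0 < d" "\<And>h. 0 < h \<Longrightarrow> h < d \<Longrightarrow> N p < N (p + h *\<^sub>R g) - h * N g"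
      by auto
    show False
      using d(2)[of "d / 2"] d(1) is_norm_triangle[OF assms(1), of p "(d / 2) *\<^sub>R g"]
      by (simp add: is_norm_scale[OF assms(1)])
  qed
  show ?thesis using le[of g] le[of "- g"] by (simp add: is_norm_minus[OF assms(1)])
qed

text \<open>Euler's identity for a function that is positively homogeneous of degree one.\<close>

lemma norm_grad_inner_self:
  assumes "is_norm N" "N differentiable (at p)"
  shows "grad N p \<bullet> p = N p"
proof -
  have "((\<lambda>t. N (p + t *\<^sub>R p)) has_real_derivative grad N p \<bullet> p) (at 0)"
    by (rule gderiv_line[OF gderiv_grad[OF assms(2)]])
  moreover have "((\<lambda>t. N (p + t *\<^sub>R p)) has_real_derivative N p) (at 0)"
  proof (rule has_field_derivative_transform_within_open)
    show "((\<lambda>t. (1 + t) * N p) has_real_derivative N p) (at 0)"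
      by (auto intro!: derivative_eq_intros)
    show "open {- 1<..<1 :: real}" by simp
    fix t :: real assume "t \<in> {- 1<..<1}"
    thus "(1 + t) * N p = N (p + t *\<^sub>R p)"
      using is_norm_scale[OF assms(1), of "1 + t" p] by (simp add: scaleR_add_left)
  qed simp
  ultimately show ?thesis by (rule DERIV_unique)
qed

text \<open>At the origin \<open>grad N 0\<close> is an arbitrary vector, but its factor
  \<open>dphi a A 0\<close> is zero. The derivative vanishes there because
  \<open>phi a A (N h)\<close> is at most \<open>dphi a A (N h) * N h\<close>, which is
  \<open>o(norm h)\<close>.\<close>

lemma gderiv_phi_norm:
  assumes "is_norm N" "\<And>p. p \<noteq> 0 \<Longrightarrow> N differentiable (at p)" "1 < a" "1 < A"
  shows "GDERIV (\<lambda>p. phi a A (N p)) p :> dphi a A (N p) *\<^sub>R grad N p"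
proof (cases "p = 0")
  case False
  show ?thesis
    using assms False is_norm_pos[OF assms(1) False]
    by (intro GDERIV_DERIV_compose gderiv_grad phi_deriv) auto
next
  case True
  obtain K where K: "0 \<le> K" "\<And>x. N x \<le> K * norm x" using is_norm_upper[OF assms(1)] by blast
  have N0: "N 0 = 0" using is_norm_eq_0[OF assms(1)] by simp
  have "continuous_on UNIV (\<lambda>h. K * dphi a A (N h))"
    using assms is_norm_nonneg[OF assms(1)]
    by (intro continuous_intros continuous_on_compose2[OF dphi_cont is_norm_continuous]) auto
  hence "isCont (\<lambda>h. K * dphi a A (N h)) 0" by (simp add: continuous_on_eq_continuous_at)
  hence lim: "((\<lambda>h. K * dphi a A (N h)) \<longlongrightarrow> 0) (at 0)"
    by (simp add: isCont_def N0)
  have bound: "norm (phi a A (N h)) / norm h \<le> K * dphi a A (N h)" if "h \<noteq> 0" for h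
  proof -
    have pos: "0 < N h" using is_norm_pos[OF assms(1) that] .
    have "phi a A (N h) \<le> dphi a A (N h) * N h"
      using phi_tangent[OF pos, of 0 a A] assms by simp
    also have "\<dots> \<le> dphi a A (N h) * (K * norm h)"
      using K(2)[of h] pos by (intro mult_left_mono dphi_nonneg) auto
    finally show ?thesis
      using that pos assms phi_nonneg[of "N h" a A] by (simp add: field_simps)
  qed
  have "((\<lambda>h. norm (phi a A (N h)) / norm h) \<longlongrightarrow> 0) (at 0)"
  proof (rule tendsto_sandwich[OF _ _ tendsto_const lim])
    show "\<forall>\<^sub>F h in at 0. norm (phi a A (N h)) / norm h \<le> K * dphi a A (N h)"
      unfolding eventually_at_filter using bound by auto
  qed auto
  hence "((\<lambda>p. phi a A (N p)) has_derivative (\<lambda>h. 0)) (at 0)"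
    unfolding has_derivative_at using N0 by simp
  thus ?thesis using True N0 by (simp add: gderiv_def)
qed

lemma hessian_works:
  assumes "grad f differentiable (at p)"
  shows "(grad f has_derivative (\<lambda>h. hessian f p *v h)) (at p)"
  using assms unfolding hessian_def jacobian_works .

lemma has_derivative_matrix_unique:
  fixes F :: "real^'n \<Rightarrow> real^'m"
  assumes "(F has_derivative (\<lambda>h. M *v h)) (at p)" "(F has_derivative G) (at p)"
  shows "M *v h = G h"
  by (rule fun_cong[OF has_derivative_unique[OF assms]])

text \<open>Euler's identity \<open>grad N q \<bullet> q = N q\<close> is differentiated at
  \<open>p\<close>; the gradient terms on both sides cancel.\<close>

lemma norm_hessian_inner_self:
  assumes "is_norm N" "\<And>p. p \<noteq> 0 \<Longrightarrow> N differentiable (at p)"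
    and "p \<noteq> 0" "grad N differentiable (at p)"
  shows "(hessian N p *v h) \<bullet> p = 0"
proof -
  have "((\<lambda>q. grad N q \<bullet> q) has_derivative
      (\<lambda>h. grad N p \<bullet> h + (hessian N p *v h) \<bullet> p)) (at p)"
    using hessian_works[OF assms(4)] by (intro has_derivative_inner) (auto intro: has_derivative_ident)
  moreover have "((\<lambda>q. grad N q \<bullet> q) has_derivative (\<lambda>h. grad N p \<bullet> h)) (at p)"
  proof (rule has_derivative_transform_within_open)
    show "(N has_derivative (\<lambda>h. grad N p \<bullet> h)) (at p)"
      using gderiv_grad[OF assms(2)[OF assms(3)]] by (simp add: gderiv_def inner_commute)
    show "open (- {0 :: real^'a})" by (intro open_Compl closed_singleton)
  qed (use assms norm_grad_inner_self[OF assms(1)] in auto)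
  ultimately have "(\<lambda>h. grad N p \<bullet> h + (hessian N p *v h) \<bullet> p) = (\<lambda>h. grad N p \<bullet> h)"
    by (rule has_derivative_unique)
  from fun_cong[OF this, of h] show ?thesis by simp
qed

lemma grad_phi_norm_has_derivative:
  assumes "is_norm N" "\<And>p. p \<noteq> 0 \<Longrightarrow> N differentiable (at p)" "1 < a" "1 < A"
    and "p \<noteq> 0" "grad N differentiable (at p)"
  shows "(grad (\<lambda>p. phi a A (N p)) has_derivative
    (\<lambda>h. dphi a A (N p) *\<^sub>R (hessian N p *v h) + (ddphi a A (N p) * (grad N p \<bullet> h)) *\<^sub>R grad N p)) (at p)"
proof -
  have g: "grad (\<lambda>p. phi a A (N p)) = (\<lambda>p. dphi a A (N p) *\<^sub>R grad N p)"
    using grad_eqI[OF gderiv_phi_norm[OF assms(1-4)]] by blast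
  have pos: "0 < N p" using is_norm_pos[OF assms(1,5)] .
  have "GDERIV (\<lambda>p. dphi a A (N p)) p :> ddphi a A (N p) *\<^sub>R grad N p"
    using assms pos by (intro GDERIV_DERIV_compose gderiv_grad dphi_deriv) auto
  hence "((\<lambda>p. dphi a A (N p)) has_derivative (\<lambda>h. ddphi a A (N p) * (grad N p \<bullet> h))) (at p)"
    by (simp add: gderiv_def inner_commute)
  thus ?thesis unfolding g
    by (rule has_derivative_scaleR[OF _ hessian_works[OF assms(6)]])
qed

lemma hessian_phi_norm:
  assumes "is_norm N" "\<And>p. p \<noteq> 0 \<Longrightarrow> N differentiable (at p)" "1 < a" "1 < A"
    and "p \<noteq> 0" "grad N differentiable (at p)"
  shows "hessian (\<lambda>p. phi a A (N p)) p *v h =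
    dphi a A (N p) *\<^sub>R (hessian N p *v h) + (ddphi a A (N p) * (grad N p \<bullet> h)) *\<^sub>R grad N p"
proof -
  note d = grad_phi_norm_has_derivative[OF assms]
  show ?thesis
    by (rule has_derivative_matrix_unique[OF hessian_works[OF differentiableI[OF d]] d])
qed

lemma ddphi_cont: "continuous_on {0<..} (ddphi a A)"
proof -
  have "x powr a + 1 \<noteq> 0" for x :: real using powr_plus_1_pos[of x a] by simp
  thus ?thesis unfolding ddphi_def[abs_def] dphi_def by (intro continuous_intros) auto
qed

lemma twice_cont_differentiable_phi_norm:
  assumes "is_norm N" "twice_cont_differentiable_on (- {0}) N" "1 < a" "1 < A"
  shows "twice_cont_differentiable_on (- {0}) (\<lambda>p. phi a A (N p))"
proof -
  let ?k = "\<lambda>p. phi a A (N p)"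
  have N: "\<And>p. p \<noteq> 0 \<Longrightarrow> N differentiable (at p)" "\<And>p. p \<noteq> 0 \<Longrightarrow> grad N differentiable (at p)"
    "continuous_on (- {0}) (hessian N)"
    using assms(2) by (auto simp: twice_cont_differentiable_on_def)
  have 1: "?k differentiable (at p)" for p
    using gderiv_phi_norm[OF assms(1) N(1) assms(3,4)] unfolding gderiv_def differentiable_def by blast
  have 2: "grad ?k differentiable (at p)" if "p \<noteq> 0" for p
    using grad_phi_norm_has_derivative[OF assms(1) N(1) assms(3,4) that N(2)[OF that]]
    by (auto intro: differentiableI)
  \<comment> \<open>Entries are read off from the action on basis vectors, which reduces continuity
    of the Hessian to that of scalar functions.\<close>
  have ent: "M $ i $ j = (M *v axis j 1) $ i" for M :: "real^'a^'a" and i j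
    by (simp add: matrix_vector_mult_basis column_def)
  have "hessian ?k p $ i $ j =
      dphi a A (N p) * hessian N p $ i $ j + ddphi a A (N p) * grad N p $ j * grad N p $ i"
    if "p \<noteq> 0" for p i j
    using hessian_phi_norm[OF assms(1) N(1) assms(3,4) that N(2)[OF that], of "axis j 1"]
    by (simp add: ent inner_axis)
  hence eq: "hessian ?k p = (\<chi> i j. dphi a A (N p) * hessian N p $ i $ j +
      ddphi a A (N p) * grad N p $ j * grad N p $ i)" if "p \<in> - {0}" for p
    using that by (simp add: vec_eq_iff)
  have cN: "continuous_on (- {0}) N" by (rule is_norm_continuous[OF assms(1)])
  have cg: "continuous_on (- {0}) (grad N)"
    using N(2) by (intro continuous_at_imp_continuous_on) (auto intro: differentiable_imp_continuous_within)
  have "continuous_on (- {0}) (\<lambda>p. dphi a A (N p))"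
    using assms is_norm_nonneg[OF assms(1)] by (intro continuous_on_compose2[OF dphi_cont cN]) auto
  moreover have "continuous_on (- {0}) (\<lambda>p. ddphi a A (N p))"
    using assms is_norm_pos[OF assms(1)] by (intro continuous_on_compose2[OF ddphi_cont cN]) auto
  ultimately have "continuous_on (- {0}) (\<lambda>p. \<chi> i j. dphi a A (N p) * hessian N p $ i $ j +
      ddphi a A (N p) * grad N p $ j * grad N p $ i)"
    using N(3) cg by (intro continuous_intros) auto
  hence "continuous_on (- {0}) (hessian ?k)"
    by (subst continuous_on_cong[OF refl eq])
  thus ?thesis using 1 2 unfolding twice_cont_differentiable_on_def by auto
qed

section \<open>The conditions for the power kinetic energy\<close>

lemma convex_on_phi_norm:
  assumes "is_norm N" "1 \<le> a" "1 \<le> A"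
  shows "convex_on UNIV (\<lambda>p. phi a A (N p))"
proof (rule convex_onI)
  fix t :: real and x y assume t: "0 < t" "t < 1"
  have "phi a A (N ((1 - t) *\<^sub>R x + t *\<^sub>R y)) \<le> phi a A ((1 - t) * N x + t * N y)"
    using assms t is_norm_convex[OF assms(1)] is_norm_nonneg[OF assms(1)] by (intro phi_mono) auto
  also have "\<dots> \<le> (1 - t) * phi a A (N x) + t * phi a A (N y)"
    using assms t is_norm_nonneg[OF assms(1)] by (intro phi_convex) auto
  finally show "phi a A (N ((1 - t) *\<^sub>R x + t *\<^sub>R y)) \<le> \<dots>" .
qed simp

text \<open>If \<open>N x = N y\<close>, strictness comes from the norm; otherwise it comes from
  \<open>phi\<close>.\<close>

lemma strictly_convex_phi_norm:
  assumes "is_norm N" "strictly_convex_norm N" "1 < a" "1 < A"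
  shows "strictly_convex (\<lambda>p. phi a A (N p))"
  unfolding strictly_convex_def
proof (intro allI impI)
  fix x y :: "real^'a" and u v :: real assume h: "x \<noteq> y \<and> 0 < u \<and> 0 < v \<and> u + v = 1"
  have nn: "0 \<le> N z" for z using is_norm_nonneg[OF assms(1)] .
  show "phi a A (N (u *\<^sub>R x + v *\<^sub>R y)) < u * phi a A (N x) + v * phi a A (N y)"
  proof (cases "N x = N y")
    case True
    have "phi a A (N (u *\<^sub>R x + v *\<^sub>R y)) < phi a A (N x)"
      using strictly_convex_normD[OF assms(1,2) True] h nn assms by (intro phi_strict_mono) auto
    also have "\<dots> = (u + v) * phi a A (N x)" using h by simp
    finally show ?thesis using True by (simp add: distrib_right)
  next
    case False
    have "phi a A (N (u *\<^sub>R x + v *\<^sub>R y)) \<le> phi a A (u * N x + v * N y)"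
      using h nn assms is_norm_convex[OF assms(1)] by (intro phi_mono) auto
    also have "\<dots> < u * phi a A (N x) + v * phi a A (N y)"
      using h nn assms False by (intro phi_strict_convex) auto
    finally show ?thesis .
  qed
qed

text \<open>This is where the value of \<alpha> comes from. For \<mu> at least 1, convexity and
  \<open>phi a A 0 = 0\<close> give the bound with factor 1. For smaller \<mu>,
  \<open>phi_scale\<close> with \<open>l = 1 / \<mu>\<close> costs \<open>\<mu> powr (- m)\<close>,
  and \<alpha> is at most \<open>\<mu> powr (m - 1)\<close>.\<close>

lemma phi_div_le:
  assumes "0 < \<mu>" "0 \<le> t" "1 < a" "1 < A"
  shows "min (min (\<mu> powr (a - 1)) (\<mu> powr (A - 1))) 1 * (\<mu> * phi a A (t / \<mu>)) \<le> phi a A t"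
proof -
  define \<alpha> where "\<alpha> = min (min (\<mu> powr (a - 1)) (\<mu> powr (A - 1))) 1"
  have nn: "0 \<le> phi a A t" "0 \<le> phi a A (t / \<mu>)" using assms by (auto intro: phi_nonneg)
  show ?thesis
  proof (cases "1 \<le> \<mu>")
    case True
    have "phi a A ((1 / \<mu>) * t + (1 - 1 / \<mu>) * 0) \<le> (1 / \<mu>) * phi a A t + (1 - 1 / \<mu>) * phi a A 0"
      using assms True by (intro phi_convex) auto
    hence "\<mu> * phi a A (t / \<mu>) \<le> phi a A t" using assms by (simp add: field_simps)
    moreover have "\<alpha> * (\<mu> * phi a A (t / \<mu>)) \<le> 1 * (\<mu> * phi a A (t / \<mu>))"
      using assms nn by (intro mult_right_mono) (auto simp: \<alpha>_def)
    ultimately show ?thesis by (simp add: \<alpha>_def)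
  next
    case False
    define m where "m = max a A"
    have "\<alpha> \<le> \<mu> powr (m - 1)" by (auto simp: \<alpha>_def m_def max_def)
    moreover have "phi a A (1 / \<mu> * t) \<le> (1 / \<mu>) powr m * phi a A t"
      unfolding m_def using assms False by (intro phi_scale) auto
    ultimately have "\<alpha> * (\<mu> * phi a A (t / \<mu>)) \<le> \<mu> powr (m - 1) * (\<mu> * ((1 / \<mu>) powr m * phi a A t))"
      using assms nn by (intro mult_mono mult_left_mono) auto
    also have "\<dots> = phi a A t" using assms by (simp add: powr_diff powr_divide)
    finally show ?thesis by (simp add: \<alpha>_def)
  qed
qed

lemma phi_conj_ge: "0 \<le> s \<Longrightarrow> ereal (t * s - phi a A s) \<le> phi_conj a A t"
  unfolding phi_conj_def by (rule SUP_upper) simp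

lemma add_le_max_mult:
  fixes x y F k M :: real
  assumes "0 \<le> F" "0 \<le> k" "x \<le> M" "y \<le> M"
  shows "x * F + y * k \<le> M * (k + F)"
  using mult_right_mono[OF assms(3,1)] mult_right_mono[OF assms(4,2)] by (simp add: algebra_simps)

section \<open>Estimates for the kinetic energy alone\<close>

locale power_kinetic_energy =
  fixes dn :: "real^'d \<Rightarrow> real" and a A :: real
  assumes dn: "is_norm dn" and dn_diff: "\<And>p. p \<noteq> 0 \<Longrightarrow> dn differentiable (at p)"
    and a: "1 < a" and A: "1 < A"
begin

abbreviation "m \<equiv> max a A"
abbreviation "k \<equiv> \<lambda>p. phi a A (dn p)"

lemma k_nonneg: "0 \<le> k p"
  using is_norm_nonneg[OF dn] a A by (intro phi_nonneg) auto

lemma k_0: "k 0 = 0"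
  using is_norm_eq_0[OF dn, of 0] by simp

lemma gderiv_k: "GDERIV k p :> dphi a A (dn p) *\<^sub>R grad dn p"
  using gderiv_phi_norm[OF dn dn_diff a A] .

lemma grad_k: "grad k p = dphi a A (dn p) *\<^sub>R grad dn p"
  using grad_eqI[OF gderiv_k] .

lemma k_differentiable: "k differentiable (at p)"
  using gderiv_k unfolding gderiv_def differentiable_def by blast

lemma abs_inner_grad_k_le: "\<bar>grad k p \<bullet> g\<bar> \<le> dphi a A (dn p) * dn g"
proof (cases "p = 0")
  case True
  thus ?thesis using is_norm_eq_0[OF dn, of 0] by (simp add: grad_k)
next
  case False
  thus ?thesis
    using norm_grad_inner_le[OF dn dn_diff[OF False], of g] dphi_nonneg[OF is_norm_nonneg[OF dn], of a A p]
    by (simp add: grad_k abs_mult mult_left_mono)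
qed

lemma inner_grad_k_self: "grad k p \<bullet> p = dphi a A (dn p) * dn p"
proof (cases "p = 0")
  case True
  thus ?thesis using is_norm_eq_0[OF dn, of 0] by simp
next
  case False
  thus ?thesis using norm_grad_inner_self[OF dn dn_diff[OF False]] by (simp add: grad_k)
qed

lemma inner_grad_k_self_le: "grad k p \<bullet> p \<le> m * k p"
  unfolding inner_grad_k_self by (intro dphi_le_phi is_norm_nonneg dn a A)

lemma dual_norm_grad_k_le: "dual_norm dn (grad k p) \<le> dphi a A (dn p)"
proof (rule dual_norm_le[OF dn])
  fix q assume "dn q = 1"
  thus "grad k p \<bullet> q \<le> dphi a A (dn p)" using abs_inner_grad_k_le[of p q] by simp
qed

text \<open>In the expanded inner product the diagonal terms are exactly
  \<open>dphi a A s * s\<close> and \<open>dphi a A t * t\<close>, and the mixed terms are at most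
  \<open>dphi a A s * t\<close> and \<open>dphi a A t * s\<close>, so the scalar inequality
  applies.\<close>

lemma k_monotone_bound:
  assumes "2 \<le> a" "2 \<le> A"
  shows "k p - k q \<le> (m - 1) * k q + (grad k p - grad k q) \<bullet> (p - q)"
proof -
  define s t where "s = dn p" and "t = dn q"
  have "phi a A s \<le> m * phi a A t + (dphi a A s - dphi a A t) * (s - t)"
    using assms is_norm_nonneg[OF dn] by (intro phi_monotone_bound) (auto simp: s_def t_def)
  also have "(dphi a A s - dphi a A t) * (s - t) \<le> (grad k p - grad k q) \<bullet> (p - q)"
    using abs_inner_grad_k_le[of p q] abs_inner_grad_k_le[of q p]
      inner_grad_k_self[of p] inner_grad_k_self[of q]
    by (simp add: inner_diff_left inner_diff_right algebra_simps s_def t_def)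
  finally show ?thesis by (simp add: algebra_simps s_def t_def)
qed

lemma quadratic_form_hessian_k:
  assumes "p \<noteq> 0" "grad dn differentiable (at p)"
  shows "g \<bullet> (hessian k p *v g) =
    dphi a A (dn p) * (g \<bullet> (hessian dn p *v g)) + ddphi a A (dn p) * (grad dn p \<bullet> g)\<^sup>2"
  by (simp add: hessian_phi_norm[OF dn dn_diff a A assms] inner_add_right inner_commute[of g "grad _ _"]
      power2_eq_square)

text \<open>In the direction \<open>p\<close> the Hessian of the norm contributes nothing, so only
  the second derivative of \<open>phi\<close> remains.\<close>

lemma quadratic_form_hessian_k_self_le:
  assumes "p \<noteq> 0" "grad dn differentiable (at p)"
  shows "p \<bullet> (hessian k p *v p) \<le> m * (m - 1) * k p"
proof -
  define s where "s = dn p"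
  have s: "0 < s" using is_norm_pos[OF dn assms(1)] by (simp add: s_def)
  have "p \<bullet> (hessian dn p *v p) = 0"
    using norm_hessian_inner_self[OF dn dn_diff assms] by (simp add: inner_commute)
  hence "p \<bullet> (hessian k p *v p) = (s * ddphi a A s) * s"
    using norm_grad_inner_self[OF dn dn_diff[OF assms(1)]]
    by (simp add: quadratic_form_hessian_k[OF assms] s_def power2_eq_square)
  also have "\<dots> \<le> ((m - 1) * dphi a A s) * s"
    using s ddphi_le(1)[OF s] by (intro mult_right_mono) auto
  also have "\<dots> = (m - 1) * (dphi a A s * s)" by simp
  also have "\<dots> \<le> (m - 1) * (m * k p)"
    using inner_grad_k_self_le[of p] a A unfolding inner_grad_k_self s_def[symmetric]
    by (intro mult_left_mono) auto
  finally show ?thesis by (simp add: mult_ac)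
qed

text \<open>The Hessian of the norm contributes \<open>N\<close> and the second derivative of
  \<open>phi\<close> contributes \<open>m - 1\<close> times the same quantity
  \<open>dphi a A s / s * T\<^sup>2\<close>, which \<open>phi_square_bound\<close> controls.\<close>

lemma quadratic_form_hessian_k_le:
  assumes "2 \<le> a" "2 \<le> A" "p \<noteq> 0" "grad dn differentiable (at p)"
    and "lambda_max dn (hessian dn p) \<le> N * inverse (dn p)" "0 < N"
  shows "g \<bullet> (hessian k p *v g) \<le> (m - 1 + N) * (2 * phi a A (dn g) + (m - 2) * k p)"
proof -
  define s T where "s = dn p" and "T = dn g"
  have s: "0 < s" and T: "0 \<le> T"
    using is_norm_pos[OF dn assms(3)] is_norm_nonneg[OF dn] by (simp_all add: s_def T_def)
  have "g \<bullet> (hessian dn p *v g) \<le> lambda_max dn (hessian dn p) * T\<^sup>2"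
    unfolding T_def by (rule quadratic_form_le_lambda_max[OF dn])
  also have "\<dots> \<le> N * inverse s * T\<^sup>2" using assms(5) by (intro mult_right_mono) (auto simp: s_def)
  finally have 1: "dphi a A s * (g \<bullet> (hessian dn p *v g)) \<le> dphi a A s * (N * inverse s * T\<^sup>2)"
    using s by (intro mult_left_mono dphi_nonneg) auto
  have "(grad dn p \<bullet> g)\<^sup>2 \<le> T\<^sup>2"
    using norm_grad_inner_le[OF dn dn_diff[OF assms(3)], of g] T by (simp add: T_def abs_le_square_iff[symmetric])
  moreover have "ddphi a A s \<le> (m - 1) * dphi a A s / s"
    using ddphi_le(1)[OF s, of a A] s by (simp add: field_simps)
  ultimately have 2: "ddphi a A s * (grad dn p \<bullet> g)\<^sup>2 \<le> (m - 1) * dphi a A s / s * T\<^sup>2"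
    using s dphi_nonneg[of s a A] a A by (intro mult_mono) auto
  have "g \<bullet> (hessian k p *v g) \<le> (m - 1 + N) * (dphi a A s / s * T\<^sup>2)"
    using add_mono[OF 1 2] s
    unfolding quadratic_form_hessian_k[OF assms(3,4)] s_def[symmetric] by (simp add: field_simps)
  also have "\<dots> \<le> (m - 1 + N) * (2 * phi a A T + (m - 2) * phi a A s)"
    using assms s T by (intro mult_left_mono phi_square_bound) auto
  finally show ?thesis by (simp add: s_def T_def)
qed

end

section \<open>Verification of conditions (A) to (D)\<close>

locale power_hamiltonian = power_kinetic_energy dn a A
  for dn :: "real^'d \<Rightarrow> real" and a A :: real +
  fixes f :: "real^'d \<Rightarrow> real" and xs :: "real^'d" and \<mu> L :: real
  assumes f_diff: "\<And>x. f differentiable (at x)" and f_convex: "convex_on UNIV f"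
    and f_min: "unique_minimizer f xs" and \<mu>: "0 < \<mu>" and L: "0 < L"
    and f_lower: "\<And>x. \<mu> * phi (a / (a - 1)) (A / (A - 1)) (dual_norm dn (x - xs)) \<le> f x - f xs"
    and grad_f_bound: "\<And>x. phi a A (dn (grad f x)) \<le> L * (f x - f xs)"
begin

abbreviation "\<alpha> \<equiv> min (min (\<mu> powr (a - 1)) (\<mu> powr (A - 1))) 1"

lemma \<alpha>_pos: "0 < \<alpha>"
  using \<mu> by simp

lemma \<alpha>_inverse: "inverse \<alpha> * \<alpha> = 1"
  by (rule left_inverse[OF less_imp_neq[OF \<alpha>_pos, symmetric]])

lemma f_ge: "0 \<le> f x - f xs"
  using f_min unfolding unique_minimizer_def by (cases "x = xs") (auto intro: less_imp_le)

text \<open>The lower bound on \<open>f\<close> is dualized: Young's inequality is applied to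
  \<open>dn p / \<mu>\<close> and the dual norm of \<open>x\<close>, then multiplied by
  \<mu>.\<close>

lemma centered_conj_le: "centered_conj f xs p \<le> ereal (\<mu> * phi a A (dn p / \<mu>))"
  unfolding centered_conj_def
proof (rule SUP_least)
  fix x
  define t where "t = dual_norm dn x"
  have t: "0 \<le> t" using is_norm_nonneg[OF is_norm_dual_norm[OF dn]] by (simp add: t_def)
  have "x \<bullet> p - centered f xs x \<le> t * dn p - \<mu> * phi (a / (a - 1)) (A / (A - 1)) t"
    using inner_le_dual_norm[OF dn, of x p] f_lower[of "x + xs"] by (simp add: centered_def t_def)
  also have "\<dots> = \<mu> * (dn p / \<mu> * t - phi (a / (a - 1)) (A / (A - 1)) t)"
    using \<mu> by (simp add: field_simps)
  also have "\<dots> \<le> \<mu> * phi a A (dn p / \<mu>)"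
    using phi_young[of "dn p / \<mu>" t a A] \<mu> t a A is_norm_nonneg[OF dn]
    by (intro mult_left_mono) (auto simp: algebra_simps)
  finally show "ereal (x \<bullet> p - centered f xs x) \<le> ereal (\<mu> * phi a A (dn p / \<mu>))" by simp
qed

lemma condition_A_convex:
  assumes "0 < \<gamma>" "\<gamma> < 1"
  shows "condition_A_convex f k xs \<gamma> (\<lambda>_. \<alpha>) \<gamma>"
proof -
  have conj: "ereal \<alpha> * max (centered_conj f xs p) (centered_conj f xs (- p)) \<le> ereal (k p)" for p
  proof -
    have "max (centered_conj f xs p) (centered_conj f xs (- p)) \<le> ereal (\<mu> * phi a A (dn p / \<mu>))"
      using centered_conj_le[of p] centered_conj_le[of "- p"] by (simp add: is_norm_minus[OF dn])
    hence "ereal \<alpha> * max (centered_conj f xs p) (centered_conj f xs (- p))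
        \<le> ereal \<alpha> * ereal (\<mu> * phi a A (dn p / \<mu>))"
      using \<alpha>_pos by (intro ereal_mult_left_mono) auto
    also have "\<dots> \<le> ereal (k p)"
      using phi_div_le[OF \<mu> is_norm_nonneg[OF dn, of p] a A] by (simp only: times_ereal.simps ereal_less_eq)
    finally show ?thesis .
  qed
  \<comment> \<open>The derivative within the half-line is determined only where the filter is
    nontrivial, so every \<open>y\<close>, including the endpoint \<open>0\<close>, must be shown to
    be a limit point.\<close>
  have vd: "vector_derivative (\<lambda>_. \<alpha>) (at y within {0..}) = 0" if "0 \<le> y" for y :: real
  proof (rule vector_derivative_within)
    have "y islimpt {0..}"
    proof (rule connected_imp_perfect)
      show "{0..} \<noteq> {c}" for c :: real
        by (metis atLeast_iff order_refl singletonD zero_le_one zero_neq_one)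
    qed (use that in \<open>auto intro: convex_connected\<close>)
    thus "at y within {0..} \<noteq> bot" by (simp add: trivial_limit_within)
  qed (auto intro: derivative_eq_intros)
  show ?thesis
    unfolding condition_A_convex_def
    using f_diff f_convex f_min k_differentiable convex_on_phi_norm[OF dn, of a A] a A k_0 k_nonneg
      assms \<alpha>_pos conj
    by (auto simp: vd monotone_on_def convex_on_def simp flip: distrib_right)
qed

lemma condition_A:
  assumes "0 < \<gamma>" "\<gamma> < 1" "strictly_convex_norm dn"
  shows "condition_A f k xs \<gamma> (\<lambda>_. \<alpha>) \<gamma>"
  unfolding condition_A_def
  using condition_A_convex[OF assms(1,2)] strictly_convex_phi_norm[OF dn assms(3) a A] by blast

lemma condition_B: "condition_B f k xs (max (max (a - 1) (A - 1)) L)"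
  unfolding condition_B_def
proof (intro conjI allI)
  define C where "C = max (max (a - 1) (A - 1)) L"
  have C: "m - 1 \<le> C" "L \<le> C" by (auto simp: C_def)
  show "0 < max (max (a - 1) (A - 1)) L" using L by simp
  fix x p
  define s T F where "s = dn p" and "T = dn (grad f x)" and "F = f x - f xs"
  have nn: "0 \<le> s" "0 \<le> T" using is_norm_nonneg[OF dn] by (auto simp: s_def T_def)
  have "\<bar>grad f x \<bullet> grad k p\<bar> \<le> dphi a A s * T"
    using abs_inner_grad_k_le[of p "grad f x"] by (simp add: inner_commute s_def T_def)
  also have "\<dots> \<le> L * F + (m - 1) * k p"
  \<comment> \<open>The tangent inequality needs a positive base point; at \<open>s = 0\<close> the
    left side vanishes.\<close>
  proof (cases "s = 0")
    case True
    thus ?thesis using L f_ge[of x] by (simp add: F_def s_def)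
  next
    case False
    have "dphi a A s * (T - s) \<le> phi a A T - phi a A s"
      using nn False a A by (intro phi_tangent) auto
    moreover have "dphi a A s * s \<le> m * phi a A s" using nn a A by (intro dphi_le_phi) auto
    ultimately show ?thesis
      using grad_f_bound[of x] by (simp add: algebra_simps F_def T_def s_def)
  qed
  also have "\<dots> \<le> C * (k p + F)"
    using f_ge[of x] k_nonneg C by (intro add_le_max_mult) (auto simp: F_def)
  finally show "\<bar>grad f x \<bullet> grad k p\<bar> \<le> max (max (a - 1) (A - 1)) L * Ham f k xs x p"
    by (simp add: C_def F_def Ham_def add_diff_eq)
qed

lemma condition_C:
  assumes "twice_cont_differentiable_on (- {xs}) f" "0 < Lf"
    and conj: "\<And>x. x \<noteq> xs \<Longrightarrow>
      phi_conj (a / (a - 1) / 2) (A / (A - 1) / 2) (lambda_max (dual_norm dn) (hessian f x) / Lf)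
        \<le> ereal (Df * (f x - f xs))"
  shows "condition_C f k xs (\<lambda>_. \<alpha>) m (Lf * inverse \<alpha> * max Df (2 * C_const a A * (m - 1)))"
proof -
  define b B C where "b = a / (a - 1)" and "B = A / (A - 1)" and "C = C_const a A"
  have b: "0 < b" "0 < B" using a A by (auto simp: b_def B_def)
  have "grad k p \<bullet> (hessian f x *v grad k p)
      \<le> Lf * inverse \<alpha> * max Df (2 * C * (m - 1)) * \<alpha> * Ham f k xs x p"
    if x: "x \<noteq> xs" for p x
  proof -
    define l r s F where "l = lambda_max (dual_norm dn) (hessian f x)"
      and "r = dual_norm dn (grad k p)" and "s = dn p" and "F = f x - f xs"
    have r: "0 \<le> r" using is_norm_nonneg[OF is_norm_dual_norm[OF dn]] by (simp add: r_def)
    have s: "0 \<le> s" using is_norm_nonneg[OF dn] by (simp add: s_def)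
    have "ereal (l / Lf * r\<^sup>2 - phi (b / 2) (B / 2) (r\<^sup>2)) \<le> ereal (Df * F)"
      using order_trans[OF phi_conj_ge conj[OF x], of "r\<^sup>2"] by (simp add: l_def b_def B_def F_def)
    moreover have "phi (b / 2) (B / 2) (r\<^sup>2) = 2 * phi b B r"
      using phi_double(1)[of r b B] r b by (cases "r = 0") auto
    moreover have "phi b B r \<le> phi b B (dphi a A s)"
      using r b dual_norm_grad_k_le[of p] by (intro phi_mono) (auto simp: r_def s_def)
    moreover have "phi b B (dphi a A s) \<le> C * (m - 1) * phi a A s"
      unfolding b_def B_def C_def using a A s by (intro phi_dphi_le)
    ultimately have "l / Lf * r\<^sup>2 \<le> Df * F + 2 * C * (m - 1) * k p"
      by (simp add: s_def)
    also have "\<dots> \<le> max Df (2 * C * (m - 1)) * (k p + F)"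
      using f_ge[of x] k_nonneg by (intro add_le_max_mult) (auto simp: F_def)
    finally have "l * r\<^sup>2 \<le> Lf * (max Df (2 * C * (m - 1)) * (k p + F))"
      using assms(2) by (simp add: field_simps)
    moreover have "grad k p \<bullet> (hessian f x *v grad k p) \<le> l * r\<^sup>2"
      unfolding l_def r_def by (rule quadratic_form_le_lambda_max[OF is_norm_dual_norm[OF dn]])
    \<comment> \<open>Condition (C) contains the constant \<alpha> as a factor, so
      \<open>inverse \<alpha> * \<alpha> = 1\<close> is inserted to match the form of
      \<open>D_{f,k}\<close>.\<close>
    ultimately have "grad k p \<bullet> (hessian f x *v grad k p)
        \<le> (inverse \<alpha> * \<alpha>) * (Lf * (max Df (2 * C * (m - 1)) * Ham f k xs x p))"
      unfolding \<alpha>_inverse by (simp add: F_def Ham_def add_diff_eq)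
    thus ?thesis by (simp only: mult_ac)
  qed
  thus ?thesis
    unfolding condition_C_def C_def using f_convex f_min assms(1) inner_grad_k_self_le by blast
qed

lemma condition_D_convex:
  assumes "2 \<le> a" "2 \<le> A" "twice_cont_differentiable_on (- {0}) dn" "0 < N"
    and lam: "\<And>p. p \<noteq> 0 \<Longrightarrow> lambda_max dn (hessian dn p) \<le> N * inverse (dn p)"
  shows "condition_D_convex f k xs (\<lambda>_. \<alpha>) m (m * (m - 1)) (m - 1) 1
    (inverse \<alpha> * (m - 1 + N) * max (2 * L) (max (a - 2) (A - 2)))"
proof -
  have d: "grad dn differentiable (at p)" if "p \<noteq> 0" for p
    using assms(3) that by (auto simp: twice_cont_differentiable_on_def)
  define M where "M = max (2 * L) (max (a - 2) (A - 2))"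
  \<comment> \<open>\<open>M\<close> dominates the coefficient \<open>2 * L\<close> of
    \<open>f x - f xs\<close> and the coefficient \<open>m - 2\<close> of
    \<open>k p\<close>.\<close>
  have M: "2 * L \<le> M" "m - 2 \<le> M" by (auto simp: M_def)
  have "grad f x \<bullet> (hessian k p *v grad f x) \<le> inverse \<alpha> * (m - 1 + N) * M * \<alpha> * Ham f k xs x p"
    if p: "p \<noteq> 0" for x p
  proof -
    define F where "F = f x - f xs"
    have "grad f x \<bullet> (hessian k p *v grad f x)
        \<le> (m - 1 + N) * (2 * phi a A (dn (grad f x)) + (m - 2) * k p)"
      using assms p d by (intro quadratic_form_hessian_k_le) auto
    also have "\<dots> \<le> (m - 1 + N) * (M * (k p + F))"
    proof (rule mult_left_mono)
      have "2 * phi a A (dn (grad f x)) + (m - 2) * k p \<le> 2 * L * F + (m - 2) * k p"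
        using grad_f_bound[of x] by (simp add: F_def)
      also have "\<dots> \<le> M * (k p + F)"
        using f_ge[of x] k_nonneg M by (intro add_le_max_mult) (auto simp: F_def)
      finally show "2 * phi a A (dn (grad f x)) + (m - 2) * k p \<le> M * (k p + F)" .
    qed (use a assms in auto)
    also have "\<dots> = (inverse \<alpha> * \<alpha>) * ((m - 1 + N) * (M * Ham f k xs x p))"
      unfolding \<alpha>_inverse by (simp add: F_def Ham_def add_diff_eq)
    also have "\<dots> = inverse \<alpha> * (m - 1 + N) * M * \<alpha> * Ham f k xs x p"
      by (simp only: mult_ac)
    finally show ?thesis .
  qed
  thus ?thesis
    unfolding condition_D_convex_def M_def
    using convex_on_phi_norm[OF dn, of a A] a A k_0 k_nonneg
      twice_cont_differentiable_phi_norm[OF dn assms(3) a A] inner_grad_k_self_le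
      quadratic_form_hessian_k_self_le[OF _ d] k_monotone_bound[OF assms(1,2)]
    by (simp add: less_imp_le)
qed

lemma condition_D:
  assumes "2 \<le> a" "2 \<le> A" "twice_cont_differentiable_on (- {0}) dn" "0 < N"
    and "\<And>p. p \<noteq> 0 \<Longrightarrow> lambda_max dn (hessian dn p) \<le> N * inverse (dn p)"
    and "strictly_convex_norm dn"
  shows "condition_D f k xs (\<lambda>_. \<alpha>) m (m * (m - 1)) (m - 1) 1
    (inverse \<alpha> * (m - 1 + N) * max (2 * L) (max (a - 2) (A - 2)))"
  unfolding condition_D_def
  using condition_D_convex[OF assms(1-5)] strictly_convex_phi_norm[OF dn assms(6) a A] by blast

end

text \<open>By \<open>strictly_convex_phi_norm_imp\<close>, strict convexity of \<open>k\<close>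
  forces \<open>dn\<close> to be strictly convex. Hence the full conditions (A) and (D) are stated
  under \<open>strictly_convex_norm dn\<close>, and their versions with plain convexity are stated
  for every norm considered.\<close>

theorem proposition4p4:
  fixes dn :: "real^'d \<Rightarrow> real"
    and f :: "real^'d \<Rightarrow> real"
    and xs :: "real^'d"
    and a A \<gamma> \<mu> L :: real
  defines "b \<equiv> a / (a - 1)"
    and "B \<equiv> A / (A - 1)"
    and "m \<equiv> max a A"
    and "k \<equiv> (\<lambda>p. phi a A (dn p))"
    and "\<alpha> \<equiv> min (min (\<mu> powr (a - 1)) (\<mu> powr (A - 1))) 1"
    and "Cfk \<equiv> max (max (a - 1) (A - 1)) L"
  assumes "is_norm dn"
    and "\<forall>p. p \<noteq> 0 \<longrightarrow> dn differentiable (at p)"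
    and "1 < a" and "1 < A" and "0 < \<gamma>" and "\<gamma> < 1"
    and "\<forall>x. f differentiable (at x)"
    and "convex_on UNIV f"
    and "unique_minimizer f xs"
    and "0 < \<mu>" and "0 < L"
    and "\<forall>x. f x - f xs \<ge> \<mu> * phi b B (dual_norm dn (x - xs))"
    and "\<forall>x. phi a A (dn (grad f x)) \<le> L * (f x - f xs)"
  shows
    "(condition_A_convex f k xs \<gamma> (\<lambda>_. \<alpha>) \<gamma> \<and>
      (strictly_convex_norm dn \<longrightarrow> condition_A f k xs \<gamma> (\<lambda>_. \<alpha>) \<gamma>) \<and>
      condition_B f k xs Cfk)
   \<and>
     (\<forall>Lf Df.
        b \<ge> 2 \<and> B \<ge> 2 \<and> twice_cont_differentiable_on (- {xs}) f \<and> 0 < Lf \<and> 0 < Df \<and>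
        (\<forall>x. x \<noteq> xs \<longrightarrow>
           phi_conj (b / 2) (B / 2) (lambda_max (dual_norm dn) (hessian f x) / Lf)
             \<le> ereal (Df * (f x - f xs)))
        \<longrightarrow>
        condition_A_convex f k xs \<gamma> (\<lambda>_. \<alpha>) \<gamma> \<and>
        (strictly_convex_norm dn \<longrightarrow> condition_A f k xs \<gamma> (\<lambda>_. \<alpha>) \<gamma>) \<and>
        condition_B f k xs Cfk \<and>
        condition_C f k xs (\<lambda>_. \<alpha>) m (Lf * inverse \<alpha> * max Df (2 * C_const a A * (m - 1))))
   \<and>
     (\<forall>N.
        b \<le> 2 \<and> B \<le> 2 \<and> twice_cont_differentiable_on (- {0}) dn \<and> 0 < N \<and>
        (\<forall>p. p \<noteq> 0 \<longrightarrow> lambda_max dn (hessian dn p) \<le> N * inverse (dn p))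
        \<longrightarrow>
        condition_A_convex f k xs \<gamma> (\<lambda>_. \<alpha>) \<gamma> \<and>
        (strictly_convex_norm dn \<longrightarrow> condition_A f k xs \<gamma> (\<lambda>_. \<alpha>) \<gamma>) \<and>
        condition_B f k xs Cfk \<and>
        condition_D_convex f k xs (\<lambda>_. \<alpha>) m (m * (m - 1)) (m - 1) 1
          (inverse \<alpha> * (m - 1 + N) * max (2 * L) (max (a - 2) (A - 2))) \<and>
        (strictly_convex_norm dn \<longrightarrow>
          condition_D f k xs (\<lambda>_. \<alpha>) m (m * (m - 1)) (m - 1) 1
            (inverse \<alpha> * (m - 1 + N) * max (2 * L) (max (a - 2) (A - 2)))))"
proof -
  interpret power_hamiltonian dn a A f xs \<mu> L
    using assms(7-) unfolding b_def B_def by unfold_locales blast+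
  note \<gamma> = \<open>0 < \<gamma>\<close> \<open>\<gamma> < 1\<close>
  have AB: "condition_A_convex f k xs \<gamma> (\<lambda>_. \<alpha>) \<gamma> \<and>
      (strictly_convex_norm dn \<longrightarrow> condition_A f k xs \<gamma> (\<lambda>_. \<alpha>) \<gamma>) \<and> condition_B f k xs Cfk"
    unfolding k_def \<alpha>_def Cfk_def using condition_A_convex[OF \<gamma>] condition_A[OF \<gamma>] condition_B by blast
  \<comment> \<open>For exponents above 1, a conjugate exponent of at most 2 means that the exponent
    itself is at least 2, which is the form used for (D).\<close>
  have ge2: "2 \<le> t" if "t / (t - 1) \<le> 2" "1 < t" for t :: real
    using that by (simp add: field_simps)
  have C: "condition_C f k xs (\<lambda>_. \<alpha>) m (Lf * inverse \<alpha> * max Df (2 * C_const a A * (m - 1)))"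
    if "twice_cont_differentiable_on (- {xs}) f" "0 < Lf"
      "\<forall>x. x \<noteq> xs \<longrightarrow>
         phi_conj (b / 2) (B / 2) (lambda_max (dual_norm dn) (hessian f x) / Lf)
           \<le> ereal (Df * (f x - f xs))" for Lf Df
    using condition_C[OF that(1,2)] that(3) unfolding k_def \<alpha>_def m_def b_def B_def by blast
  have D: "condition_D_convex f k xs (\<lambda>_. \<alpha>) m (m * (m - 1)) (m - 1) 1
          (inverse \<alpha> * (m - 1 + N) * max (2 * L) (max (a - 2) (A - 2))) \<and>
        (strictly_convex_norm dn \<longrightarrow>
          condition_D f k xs (\<lambda>_. \<alpha>) m (m * (m - 1)) (m - 1) 1
            (inverse \<alpha> * (m - 1 + N) * max (2 * L) (max (a - 2) (A - 2))))"
    if "b \<le> 2" "B \<le> 2" "twice_cont_differentiable_on (- {0}) dn" "0 < N"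
      "\<forall>p. p \<noteq> 0 \<longrightarrow> lambda_max dn (hessian dn p) \<le> N * inverse (dn p)" for N
    using condition_D_convex[OF _ _ that(3,4)] condition_D[OF _ _ that(3,4)] that(5)
      ge2[OF that(1)[unfolded b_def] a] ge2[OF that(2)[unfolded B_def] A]
    unfolding k_def \<alpha>_def m_def by blast
  show ?thesis using AB C D by blast
qed

end
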